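(* Let $A$ be an $n$-by-$n$ complex matrix and let $\ell>a(A)$ be an integer. Then the following conditions are equivalent: (a) $A,A^2,\ldots,A^\ell$ are partial isometries. (b) $A$ is unitarily similar to a matrix of the form $U\oplus J_{k_1}\oplus\cdots\oplus J_{k_m}$, where $U$ is unitary and $a(A)=k_1\ge\cdots\ge k_m\ge 1$. (c) $A^j$ is a partial isometry for all $j\ge 1$.
   Context: An $n$-by-$n$ complex matrix $A$ is a partial isometry if $\|Ax\|=\|x\|$ for every $x\in(\ker A)^\perp$ (standard norm on $\mathbb{C}^n$). The ascent $a(A)$ is the minimal integer $k\ge 0$ with $\ker A^k=\ker A^{k+1}$ (where $A^0=I_n$). $J_j$ is the $j$-by-$j$ nilpotent Jordan block, with $1$'s on the first superdiagonal and $0$'s elsewhere. In (b), the unitary summand $U$ may be absent (size $0$), and when $a(A)=0$ the Jordan block summands are absent. *)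

theory Defs
  imports
    "HOL-Analysis.L2_Norm"
    "Jordan_Normal_Form.Matrix_Kernel"
    "Jordan_Normal_Form.Jordan_Normal_Form"
    "Jordan_Normal_Form.Schur_Decomposition"
begin

definition vec_norm2 :: "complex vec \<Rightarrow> real" where
  "vec_norm2 v = L2_set (\<lambda>i. cmod (v $ i)) {..<dim_vec v}"

definition orth_compl :: "nat \<Rightarrow> complex vec set \<Rightarrow> complex vec set" where
  "orth_compl n W = {x \<in> carrier_vec n. \<forall>w\<in>W. x \<bullet>c w = 0}"

definition partial_isometry :: "complex mat \<Rightarrow> bool" where
  "partial_isometry A \<longleftrightarrow>
     (\<forall>x \<in> orth_compl (dim_col A) (mat_kernel A). vec_norm2 (A *\<^sub>v x) = vec_norm2 x)"

(* For a square matrix the kernels of the powers form an increasing chain of subspaces of a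
   finite-dimensional space, so the LEAST below ranges over a nonempty set. *)
definition ascent :: "complex mat \<Rightarrow> nat" where
  "ascent A = (LEAST k. mat_kernel (A ^\<^sub>m k) = mat_kernel (A ^\<^sub>m (k + 1)))"

(* The 0-by-0 matrix is unitary; it plays the role of an absent unitary summand. *)
definition unitary_mat :: "complex mat \<Rightarrow> bool" where
  "unitary_mat U \<longleftrightarrow> square_mat U \<and>
     mat_adjoint U * U = 1\<^sub>m (dim_row U) \<and> U * mat_adjoint U = 1\<^sub>m (dim_row U)"

definition unitarily_similar :: "complex mat \<Rightarrow> complex mat \<Rightarrow> bool" where
  "unitarily_similar A B \<longleftrightarrow>
     (\<exists>P. unitary_mat P \<and> similar_mat_wit A B P (mat_adjoint P))"

end

theory Submission
  imports Defs
begin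

text \<open>
  A square matrix is a partial isometry iff \<open>A A\<^sup>* A = A\<close>, which is stable under direct sums and
  unitary similarity; hence (b) implies (c). Given (a), put \<open>E\<^sub>j = (A\<^sup>j)\<^sup>* A\<^sup>j\<close>. At the ascent \<open>k\<close> the
  kernels of \<open>A\<^sup>k\<close> and \<open>A\<^sup>k\<^sup>+\<^sup>1\<close> agree, so \<open>E\<^sub>k = E\<^sub>k\<^sub>+\<^sub>1\<close>, and \<open>E\<^sub>j\<^sub>+\<^sub>1 = A\<^sup>* E\<^sub>j A\<close> keeps this projection
  constant from there on, which gives (c). For (c) implies (b), choose a unit vector \<open>y\<close> in
  \<open>ker A \<inter> ran A\<^sup>k\<^sup>-\<^sup>1\<close>. The vectors \<open>y, A\<^sup>* y, \<dots>, (A\<^sup>*)\<^sup>k\<^sup>-\<^sup>1 y\<close> are orthonormal and span a reducing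
  subspace on which \<open>A\<close> acts as \<open>J\<^sub>k\<close>. Splitting off a block of maximal size \<open>k\<close> each time produces
  the blocks in decreasing order, until the ascent is 0 and the remaining summand is unitary.
\<close>

section \<open>Powers and adjoints\<close>

lemma pow_mat_add:
  assumes A: "A \<in> carrier_mat n n"
  shows "A ^\<^sub>m (i + j) = A ^\<^sub>m i * A ^\<^sub>m j"
proof (induction j)
  case 0
  then show ?case using A by simp
next
  case (Suc j)
  then show ?case
    using A assoc_mult_mat[OF pow_carrier_mat[OF A] pow_carrier_mat[OF A] A] by simp
qed

lemma pow_mat_Suc_left:
  assumes A: "A \<in> carrier_mat n n"
  shows "A ^\<^sub>m Suc k = A * A ^\<^sub>m k"
  using pow_mat_add[OF A, of 1 k] A by simp

lemma pow_mat_add_vec: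
  assumes A: "A \<in> carrier_mat n n" and x: "x \<in> carrier_vec n"
  shows "A ^\<^sub>m (i + j) *\<^sub>v x = A ^\<^sub>m i *\<^sub>v (A ^\<^sub>m j *\<^sub>v x)"
  using A x by (simp add: pow_mat_add[OF A] assoc_mult_mat_vec[of _ n n _ n])

lemma mult_mat_vec_carrier_square [simp]:
  "A \<in> carrier_mat n n \<Longrightarrow> x \<in> carrier_vec n \<Longrightarrow> A *\<^sub>v x \<in> carrier_vec n"
  by simp

lemma mult_mat_vec_zero [simp]:
  "A \<in> carrier_mat m n \<Longrightarrow> A *\<^sub>v 0\<^sub>v n = 0\<^sub>v m"
  by (intro eq_vecI) auto

lemma mat_eqI_mult_vec:
  fixes A B :: "'a :: semiring_1 mat"
  assumes A: "A \<in> carrier_mat m n" and B: "B \<in> carrier_mat m n"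
    and eq: "\<And>x. x \<in> carrier_vec n \<Longrightarrow> A *\<^sub>v x = B *\<^sub>v x"
  shows "A = B"
proof (rule eq_matI)
  fix i j assume "i < dim_row B" "j < dim_col B"
  then have i: "i < m" and j: "j < n" using B by auto
  have "(A *\<^sub>v unit_vec n j) $ i = (B *\<^sub>v unit_vec n j) $ i"
    using eq[of "unit_vec n j"] by simp
  then show "A $$ (i, j) = B $$ (i, j)" using A B i j by simp
qed (use A B in auto)

lemma mat_adjoint_dim [simp]:
  "dim_row (mat_adjoint A) = dim_col A" "dim_col (mat_adjoint A) = dim_row A"
  by (auto simp: mat_adjoint_def)

lemma mat_adjoint_index [simp]:
  "i < dim_col A \<Longrightarrow> j < dim_row A \<Longrightarrow> mat_adjoint A $$ (i, j) = conjugate (A $$ (j, i))"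
  by (simp add: mat_adjoint_def mat_of_rows_index)

lemma mat_adjoint_carrier [simp]:
  "A \<in> carrier_mat m n \<Longrightarrow> mat_adjoint A \<in> carrier_mat n m"
  by (intro carrier_matI) simp_all

lemma mat_adjoint_adjoint [simp]: "mat_adjoint (mat_adjoint A) = A"
  by (rule eq_matI) auto

lemma mat_adjoint_one [simp]: "mat_adjoint (1\<^sub>m n :: complex mat) = 1\<^sub>m n"
  by (rule eq_matI) auto

lemma mat_adjoint_zero [simp]: "mat_adjoint (0\<^sub>m m n) = 0\<^sub>m n m"
  by (rule eq_matI) auto

lemma mat_adjoint_mult:
  fixes A :: "complex mat"
  assumes "A \<in> carrier_mat m n" "B \<in> carrier_mat n k"
  shows "mat_adjoint (A * B) = mat_adjoint B * mat_adjoint A"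
  using assms by (intro eq_matI) (auto simp: scalar_prod_def mult.commute)

lemma mat_adjoint_pow:
  fixes A :: "complex mat"
  assumes A: "A \<in> carrier_mat n n"
  shows "mat_adjoint (A ^\<^sub>m k) = mat_adjoint A ^\<^sub>m k"
proof (induction k)
  case 0
  then show ?case using A by simp
next
  case (Suc k)
  have "mat_adjoint (A ^\<^sub>m Suc k) = mat_adjoint A * mat_adjoint A ^\<^sub>m k"
    using mat_adjoint_mult[OF pow_carrier_mat[OF A] A, of k] Suc by simp
  also have "\<dots> = mat_adjoint A ^\<^sub>m Suc k"
    using pow_mat_Suc_left[OF mat_adjoint_carrier[OF A]] by simp
  finally show ?case .
qed

lemma mat_adjoint_four_block:
  assumes "A \<in> carrier_mat nr1 nc1" "B \<in> carrier_mat nr1 nc2"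
    "C \<in> carrier_mat nr2 nc1" "D \<in> carrier_mat nr2 nc2"
  shows "mat_adjoint (four_block_mat A B C D) =
    four_block_mat (mat_adjoint A) (mat_adjoint C) (mat_adjoint B) (mat_adjoint D)"
  using assms by (intro eq_matI) auto

section \<open>Inner products, adjoints and norms\<close>

lemma cscalar_prod_adjoint:
  fixes A :: "complex mat"
  assumes "A \<in> carrier_mat m n" "x \<in> carrier_vec n" "y \<in> carrier_vec m"
  shows "(A *\<^sub>v x) \<bullet>c y = x \<bullet>c (mat_adjoint A *\<^sub>v y)"
proof -
  have "(A *\<^sub>v x) \<bullet>c y = (\<Sum>i<m. \<Sum>j<n. A $$ (i, j) * x $ j * cnj (y $ i))"
    using assms by (simp add: scalar_prod_def sum_distrib_right lessThan_atLeast0)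
  also have "\<dots> = (\<Sum>j<n. \<Sum>i<m. A $$ (i, j) * x $ j * cnj (y $ i))"
    by (rule sum.swap)
  also have "\<dots> = x \<bullet>c (mat_adjoint A *\<^sub>v y)"
    using assms by (simp add: scalar_prod_def sum_distrib_left lessThan_atLeast0 mult_ac)
  finally show ?thesis .
qed

lemma cscalar_prod_adjoint':
  fixes A :: "complex mat"
  assumes "A \<in> carrier_mat m n" "x \<in> carrier_vec m" "y \<in> carrier_vec n"
  shows "x \<bullet>c (A *\<^sub>v y) = (mat_adjoint A *\<^sub>v x) \<bullet>c y"
  using cscalar_prod_adjoint[of "mat_adjoint A" n m x y] assms by simp

lemma cscalar_prod_commute:
  fixes x y :: "complex vec"
  assumes "x \<in> carrier_vec n" "y \<in> carrier_vec n"
  shows "x \<bullet>c y = cnj (y \<bullet>c x)"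
  using assms by (simp add: scalar_prod_def mult.commute)

lemma conjugate_minus_vec:
  fixes x y :: "complex vec"
  assumes "x \<in> carrier_vec n" "y \<in> carrier_vec n"
  shows "conjugate (x - y) = conjugate x - conjugate y"
  using assms by (intro eq_vecI) auto

text \<open>Each \<open>v \<bullet>c v\<close> is the square of a nonnegative norm, so isometry
  conditions can be computed with inner products alone.\<close>

lemma vec_norm2_eq_iff:
  "vec_norm2 x = vec_norm2 y \<longleftrightarrow> x \<bullet>c x = y \<bullet>c y"
proof -
  have sq: "v \<bullet>c v = of_real ((vec_norm2 v)\<^sup>2)" for v
  proof -
    have "v \<bullet>c v = (\<Sum>i<dim_vec v. v $ i * cnj (v $ i))"
      by (simp add: scalar_prod_def lessThan_atLeast0)
    also have "\<dots> = (\<Sum>i<dim_vec v. of_real ((cmod (v $ i))\<^sup>2))"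
      by (intro sum.cong refl complex_norm_square[symmetric])
    finally show ?thesis by (simp add: vec_norm2_def L2_set_def sum_nonneg)
  qed
  have "vec_norm2 v \<ge> 0" for v by (simp add: vec_norm2_def)
  then have "(vec_norm2 x)\<^sup>2 = (vec_norm2 y)\<^sup>2 \<longleftrightarrow> vec_norm2 x = vec_norm2 y"
    by (intro power2_eq_iff_nonneg)
  then show ?thesis by (simp only: sq of_real_eq_iff)
qed

lemma vec_eqI_minus:
  fixes x y :: "complex vec"
  assumes "x \<in> carrier_vec n" "y \<in> carrier_vec n" "x - y = 0\<^sub>v n"
  shows "x = y"
proof (rule eq_vecI)
  fix i assume "i < dim_vec y"
  then have "(x - y) $ i = 0" using assms by simp
  then show "x $ i = y $ i" using \<open>i < dim_vec y\<close> assms(1,2) by simp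
qed (use assms in auto)

section \<open>Partial isometries\<close>

text \<open>Polarization along one direction: in the expansion of the quadratic form at
  \<open>z + T *\<^sub>v z\<close> the two diagonal terms vanish, and both mixed terms equal the
  squared norm of \<open>T *\<^sub>v z\<close>.\<close>

lemma hermitian_mat_zero:
  fixes T :: "complex mat"
  assumes T: "T \<in> carrier_mat n n" and herm: "mat_adjoint T = T"
    and quad: "\<And>z. z \<in> carrier_vec n \<Longrightarrow> (T *\<^sub>v z) \<bullet>c z = 0"
    and z: "z \<in> carrier_vec n"
  shows "T *\<^sub>v z = 0\<^sub>v n"
proof -
  define y where "y = T *\<^sub>v z"
  have y: "y \<in> carrier_vec n" using T z by (simp add: y_def)
  have Ty: "T *\<^sub>v y \<in> carrier_vec n" using T y by simp
  have "(T *\<^sub>v y) \<bullet>c z = y \<bullet>c y"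
    using cscalar_prod_adjoint[OF T y z] herm y_def by simp
  moreover have "(T *\<^sub>v (z + y)) \<bullet>c (z + y) =
      (y \<bullet>c z + (T *\<^sub>v y) \<bullet>c z) + (y \<bullet>c y + (T *\<^sub>v y) \<bullet>c y)"
    using y z Ty
    by (simp add: mult_add_distrib_mat_vec[OF T] y_def[symmetric] conjugate_add_vec[of _ n]
        scalar_prod_add_distrib[of _ n] add_scalar_prod_distrib[of _ n])
  ultimately have "y \<bullet>c y = 0"
    using quad[of "z + y"] quad[OF z] quad[OF y] y z by (simp add: y_def[symmetric])
  then show ?thesis using conjugate_square_eq_0_vec[OF y] by (simp add: y_def)
qed

text \<open>The range of the adjoint is orthogonal to the kernel, so \<open>A\<close> is isometric
  on every \<open>A\<^sup>* z\<close>. For \<open>M = A A\<^sup>*\<close> this says that the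
  quadratic form of \<open>M\<^sup>2 - M\<close> vanishes, so \<open>M\<close> is a projection.
  Hence \<open>A\<^sup>* M = A\<^sup>*\<close>, and taking adjoints gives the claim. No orthogonal
  decomposition of the space is needed.\<close>

lemma partial_isometryD:
  fixes A :: "complex mat"
  assumes A: "A \<in> carrier_mat n n" and pi: "partial_isometry A"
  shows "A * mat_adjoint A * A = A"
proof -
  let ?B = "mat_adjoint A"
  have B: "?B \<in> carrier_mat n n" using A by simp
  define M where "M = A * ?B"
  have M: "M \<in> carrier_mat n n" using A by (simp add: M_def)
  have Mh: "mat_adjoint M = M" using mat_adjoint_mult[OF A B] by (simp add: M_def)
  have Mv: "M *\<^sub>v z = A *\<^sub>v (?B *\<^sub>v z)" if "z \<in> carrier_vec n" for z
    using A B that by (simp add: M_def assoc_mult_mat_vec[of _ n n _ n])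
  define T where "T = M * M - M"
  have T: "T \<in> carrier_mat n n" using M by (auto simp: T_def intro!: minus_carrier_mat)
  have Tv: "T *\<^sub>v z = M *\<^sub>v (M *\<^sub>v z) - M *\<^sub>v z" if "z \<in> carrier_vec n" for z
    using M that by (simp add: T_def minus_mult_distrib_mat_vec[of _ n n] )
  have Th: "mat_adjoint T = T"
  proof -
    have "mat_adjoint T = mat_adjoint (M * M) - mat_adjoint M"
      using M by (intro eq_matI) (auto simp: T_def)
    then show ?thesis using mat_adjoint_mult[OF M M] Mh by (simp add: T_def)
  qed
  have quad: "(T *\<^sub>v z) \<bullet>c z = 0" if z: "z \<in> carrier_vec n" for z
  proof -
    let ?w = "?B *\<^sub>v z"
    have w: "?w \<in> carrier_vec n" using B z by simp
    have "?w \<bullet>c u = 0" if "u \<in> mat_kernel A" for u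
      using mat_kernelD[OF A that] cscalar_prod_adjoint[OF B z, of u] z by simp
    then have "?w \<in> orth_compl (dim_col A) (mat_kernel A)"
      using A w by (simp add: orth_compl_def)
    then have "(A *\<^sub>v ?w) \<bullet>c (A *\<^sub>v ?w) = ?w \<bullet>c ?w"
      using pi unfolding partial_isometry_def vec_norm2_eq_iff by blast
    then have "(M *\<^sub>v (M *\<^sub>v z)) \<bullet>c z = (M *\<^sub>v z) \<bullet>c z"
      using cscalar_prod_adjoint[OF M mult_mat_vec_carrier[OF M z] z] cscalar_prod_adjoint'[OF B w z] Mh M z
        Mv[OF z] Mv[OF mult_mat_vec_carrier[OF M z]]
      by simp
    then show ?thesis
      using M z by (simp add: Tv minus_scalar_prod_distrib[of _ n])
  qed
  have "?B *\<^sub>v (M *\<^sub>v z) = ?B *\<^sub>v z" if z: "z \<in> carrier_vec n" for z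
  proof -
    have Mz: "M *\<^sub>v z \<in> carrier_vec n" "M *\<^sub>v (M *\<^sub>v z) \<in> carrier_vec n" using M z by auto
    have BMz: "?B *\<^sub>v (M *\<^sub>v z) \<in> carrier_vec n" "?B *\<^sub>v z \<in> carrier_vec n" using B Mz z by auto
    define d where "d = M *\<^sub>v z - z"
    have d: "d \<in> carrier_vec n" using Mz z by (simp add: d_def)
    have Bd: "?B *\<^sub>v d = ?B *\<^sub>v (M *\<^sub>v z) - ?B *\<^sub>v z"
      unfolding d_def using mult_minus_distrib_mat_vec[OF B Mz(1) z] .
    \<comment> \<open>As \<open>M = A A\<^sup>*\<close>, the left side is
      \<open>M (M z - z)\<close>. It vanishes, and its inner product with \<open>d\<close> is the
      squared norm of \<open>A\<^sup>* d\<close>.\<close>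
    have "A *\<^sub>v (?B *\<^sub>v d) = T *\<^sub>v z"
      using mult_minus_distrib_mat_vec[OF M Mz(1) z] Tv[OF z] Mv[OF d] by (simp add: d_def)
    then have "(?B *\<^sub>v d) \<bullet>c (?B *\<^sub>v d) = 0"
      using hermitian_mat_zero[OF T Th quad z] cscalar_prod_adjoint'[OF B, of "?B *\<^sub>v d" d] d B
      by simp
    then have "?B *\<^sub>v d = 0\<^sub>v n" using conjugate_square_eq_0_vec[of "?B *\<^sub>v d" n] B d by simp
    then show ?thesis using vec_eqI_minus[OF BMz] Bd by simp
  qed
  then have "?B * M = ?B" using B M by (intro mat_eqI_mult_vec[of _ n n]) auto
  then have "mat_adjoint (?B * M) = A" by simp
  then show ?thesis using mat_adjoint_mult[OF B M] Mh by (simp add: M_def)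
qed

text \<open>The identity puts \<open>x - A\<^sup>* A x\<close> into the kernel. For \<open>x\<close>
  orthogonal to the kernel, the squared norm of \<open>x\<close> is therefore the inner product of
  \<open>x\<close> with \<open>A\<^sup>* A x\<close>, that is, the squared norm of
  \<open>A x\<close>.\<close>

lemma partial_isometryI:
  fixes A :: "complex mat"
  assumes A: "A \<in> carrier_mat n n" and eq: "A * mat_adjoint A * A = A"
  shows "partial_isometry A"
  unfolding partial_isometry_def vec_norm2_eq_iff
proof
  let ?B = "mat_adjoint A"
  have B: "?B \<in> carrier_mat n n" using A by simp
  fix x assume "x \<in> orth_compl (dim_col A) (mat_kernel A)"
  then have x: "x \<in> carrier_vec n" and orth: "\<And>w. w \<in> mat_kernel A \<Longrightarrow> x \<bullet>c w = 0"
    using A by (auto simp: orth_compl_def)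
  let ?y = "?B *\<^sub>v (A *\<^sub>v x)"
  have y: "?y \<in> carrier_vec n" using A B x by simp
  have "A *\<^sub>v ?y = (A * ?B * A) *\<^sub>v x"
    using A B x by (simp add: assoc_mult_mat_vec[of _ n n _ n])
  then have "A *\<^sub>v (x - ?y) = A *\<^sub>v x - A *\<^sub>v x"
    using mult_minus_distrib_mat_vec[OF A x y] eq by simp
  then have "x - ?y \<in> mat_kernel A"
    using A x y by (intro mat_kernelI[of _ n n]) auto
  then have "x \<bullet>c x = x \<bullet>c ?y"
    using orth[of "x - ?y"] x y
    by (simp add: conjugate_minus_vec[of _ n] scalar_prod_minus_distrib[of _ n])
  then show "(A *\<^sub>v x) \<bullet>c (A *\<^sub>v x) = x \<bullet>c x"
    using cscalar_prod_adjoint[OF A x, of "A *\<^sub>v x"] A x by simp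
qed

lemma partial_isometry_iff:
  fixes A :: "complex mat"
  assumes "A \<in> carrier_mat n n"
  shows "partial_isometry A \<longleftrightarrow> A * mat_adjoint A * A = A"
  using partial_isometryI[OF assms] partial_isometryD[OF assms] by blast

lemma partial_isometry_mult_vec:
  fixes A :: "complex mat"
  assumes A: "A \<in> carrier_mat n n" and "partial_isometry A" and x: "x \<in> carrier_vec n"
  shows "A *\<^sub>v (mat_adjoint A *\<^sub>v (A *\<^sub>v x)) = A *\<^sub>v x"
proof -
  have "A *\<^sub>v (mat_adjoint A *\<^sub>v (A *\<^sub>v x)) = (A * mat_adjoint A * A) *\<^sub>v x"
    using A x by (simp add: assoc_mult_mat_vec[of _ n n _ n])
  then show ?thesis using partial_isometryD[OF assms(1,2)] by simp
qed

lemma partial_isometry_adjoint: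
  fixes A :: "complex mat"
  assumes A: "A \<in> carrier_mat n n" and pi: "partial_isometry A"
  shows "partial_isometry (mat_adjoint A)"
proof -
  have "mat_adjoint (A * mat_adjoint A * A) = mat_adjoint A * (A * mat_adjoint A)"
    using A by (simp add: mat_adjoint_mult[of _ n n _ n])
  then have "mat_adjoint A * A * mat_adjoint A = mat_adjoint A"
    using A partial_isometryD[OF A pi] by (simp add: assoc_mult_mat[of _ n n _ n _ n])
  then show ?thesis using A by (intro partial_isometryI[of _ n]) auto
qed

section \<open>Kernels, and their stabilisation along the powers of a matrix\<close>

text \<open>\<open>X - Y\<close> maps into the kernel of \<open>A\<close>, hence into that of
  \<open>B\<close>. This transports an identity from one power of a matrix to another, and with
  \<open>B = 1\<close> it cancels an injective factor.\<close>

lemma mat_kernel_cancel_left: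
  fixes A B :: "complex mat"
  assumes A: "A \<in> carrier_mat n n" and B: "B \<in> carrier_mat n n"
    and X: "X \<in> carrier_mat n n" and Y: "Y \<in> carrier_mat n n"
    and ker: "mat_kernel A \<subseteq> mat_kernel B" and eq: "A * X = A * Y"
  shows "B * X = B * Y"
proof (rule mat_eqI_mult_vec[of _ n n])
  fix z :: "complex vec" assume z: "z \<in> carrier_vec n"
  have v: "X *\<^sub>v z \<in> carrier_vec n" "Y *\<^sub>v z \<in> carrier_vec n" using X Y z by auto
  have "A *\<^sub>v (X *\<^sub>v z) = A *\<^sub>v (Y *\<^sub>v z)"
    using arg_cong[OF eq, of "\<lambda>M. M *\<^sub>v z"] A X Y z by (simp add: assoc_mult_mat_vec[of _ n n _ n])
  then have "A *\<^sub>v (X *\<^sub>v z - Y *\<^sub>v z) = 0\<^sub>v n"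
    using A v by (simp add: mult_minus_distrib_mat_vec[OF A])
  then have "X *\<^sub>v z - Y *\<^sub>v z \<in> mat_kernel B"
    using ker A v mat_kernelI[OF A, of "X *\<^sub>v z - Y *\<^sub>v z"] by auto
  then have "B *\<^sub>v (X *\<^sub>v z) - B *\<^sub>v (Y *\<^sub>v z) = 0\<^sub>v n"
    using mat_kernelD[OF B] v by (simp add: mult_minus_distrib_mat_vec[OF B, symmetric])
  then have "B *\<^sub>v (X *\<^sub>v z) = B *\<^sub>v (Y *\<^sub>v z)"
    using vec_eqI_minus[of "B *\<^sub>v (X *\<^sub>v z)" n "B *\<^sub>v (Y *\<^sub>v z)"] B v by simp
  then show "(B * X) *\<^sub>v z = (B * Y) *\<^sub>v z"
    using B X Y z by (simp add: assoc_mult_mat_vec[of _ n n _ n])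
qed (use B X Y in auto)

text \<open>Padding the \<open>m < n\<close> equations with zero rows gives a square matrix whose
  determinant vanishes.\<close>

lemma wide_system_nontrivial:
  fixes f :: "nat \<Rightarrow> 'a :: idom vec"
  assumes "m < n"
  shows "\<exists>v\<in>carrier_vec n. v \<noteq> 0\<^sub>v n \<and> (\<forall>i<m. (\<Sum>j<n. f i $ j * v $ j) = 0)"
proof -
  define M where "M = mat n n (\<lambda>(i, j). if i < m then f i $ j else 0)"
  have M: "M \<in> carrier_mat n n" by (simp add: M_def)
  \<comment> \<open>Row \<open>n - 1\<close> of \<open>M\<close> is already zero because
    \<open>m < n\<close>; the matrix is only rewritten into the shape of
    \<open>det_row_0\<close>.\<close>
  have "mat\<^sub>r n n (\<lambda>i. if i = n - 1 then 0\<^sub>v n else row M i) = M"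
    using assms by (intro eq_matI) (auto simp: M_def)
  moreover have "det (mat\<^sub>r n n (\<lambda>i. if i = n - 1 then 0\<^sub>v n else row M i)) = 0"
    using assms M by (intro det_row_0) auto
  ultimately obtain v where v: "v \<in> carrier_vec n" "v \<noteq> 0\<^sub>v n" "M *\<^sub>v v = 0\<^sub>v n"
    using det_0_iff_vec_prod_zero[OF M] by auto
  have "(\<Sum>j<n. f i $ j * v $ j) = 0" if "i < m" for i
  proof -
    have "(M *\<^sub>v v) $ i = (\<Sum>j<n. f i $ j * v $ j)"
      using that assms v(1) by (simp add: M_def scalar_prod_def lessThan_atLeast0)
    then show ?thesis using v(3) that assms by simp
  qed
  then show ?thesis using v by blast
qed

lemma mat_kernel_pow_Suc_subset:
  fixes A :: "complex mat"
  assumes A: "A \<in> carrier_mat n n"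
  shows "mat_kernel (A ^\<^sub>m k) \<subseteq> mat_kernel (A ^\<^sub>m (k + 1))"
  using mat_kernel_mult_subset[OF pow_carrier_mat[OF A] A] pow_mat_Suc_left[OF A] by simp

text \<open>Otherwise \<open>x, A x, \<dots>, A\<^sup>n x\<close> would be \<open>n + 1\<close> linearly independent vectors: in a
  nontrivial relation, apply \<open>A\<^sup>n\<^sup>-\<^sup>p\<close>, where \<open>p\<close> is the index of the first nonzero coefficient.\<close>

lemma mat_kernel_pow_dim:
  fixes A :: "complex mat"
  assumes A: "A \<in> carrier_mat n n"
  shows "mat_kernel (A ^\<^sub>m n) = mat_kernel (A ^\<^sub>m (n + 1))"
proof (rule ccontr)
  assume "mat_kernel (A ^\<^sub>m n) \<noteq> mat_kernel (A ^\<^sub>m (n + 1))"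
  then obtain x where "x \<in> mat_kernel (A ^\<^sub>m (n + 1))" and nx: "x \<notin> mat_kernel (A ^\<^sub>m n)"
    using mat_kernel_pow_Suc_subset[OF A, of n] by blast
  then have x: "x \<in> carrier_vec n" and zero: "A ^\<^sub>m (n + 1) *\<^sub>v x = 0\<^sub>v n"
    using mat_kernelD[OF pow_carrier_mat[OF A]] by blast+
  have nz: "A ^\<^sub>m n *\<^sub>v x \<noteq> 0\<^sub>v n"
    using nx x mat_kernelI[OF pow_carrier_mat[OF A, of n], of x] by blast
  define a where "a j = A ^\<^sub>m j *\<^sub>v x" for j
  have a: "a j \<in> carrier_vec n" for j using A x by (simp add: a_def)
  have a0: "a j = 0\<^sub>v n" if "j > n" for j
  proof -
    have "a j = A ^\<^sub>m (j - (n + 1)) *\<^sub>v (A ^\<^sub>m (n + 1) *\<^sub>v x)"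
      using pow_mat_add_vec[OF A x, of "j - (n + 1)" "n + 1"] that by (simp add: a_def)
    then show ?thesis using A by (simp only: zero mult_mat_vec_zero[OF pow_carrier_mat[OF A]])
  qed
  obtain v where v: "v \<in> carrier_vec (Suc n)" "v \<noteq> 0\<^sub>v (Suc n)"
    and rel: "\<And>i. i < n \<Longrightarrow> (\<Sum>j<Suc n. vec (Suc n) (\<lambda>j. a j $ i) $ j * v $ j) = 0"
    using wide_system_nontrivial[of n "Suc n" "\<lambda>i. vec (Suc n) (\<lambda>j. a j $ i)"] by auto
  define K where "K = mat n (Suc n) (\<lambda>(i, j). a j $ i)"
  have K: "K \<in> carrier_mat n (Suc n)" by (simp add: K_def)
  have Kv: "K *\<^sub>v v = 0\<^sub>v n"
    using rel v(1) by (intro eq_vecI) (simp_all add: K_def scalar_prod_def lessThan_atLeast0)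
  define p where "p = (LEAST p. p < Suc n \<and> v $ p \<noteq> 0)"
  have "\<exists>p. p < Suc n \<and> v $ p \<noteq> 0"
  proof (rule ccontr)
    assume "\<not> ?thesis"
    then have "v = 0\<^sub>v (Suc n)" using v(1) by (intro eq_vecI) auto
    then show False using v(2) by simp
  qed
  then have p: "p < Suc n" "v $ p \<noteq> 0"
    unfolding p_def by (metis (mono_tags, lifting) LeastI_ex)+
  have below: "v $ j = 0" if "j < p" for j
    using not_less_Least[of j "\<lambda>p. p < Suc n \<and> v $ p \<noteq> 0"] that p(1) unfolding p_def[symmetric] by auto
  let ?N = "A ^\<^sub>m (n - p)"
  have N: "?N \<in> carrier_mat n n" using A by simp
  have "(a n) $ i = 0" if i: "i < n" for i
  proof -
    have NK: "(?N * K) $$ (i, j) = a (n - p + j) $ i" if j: "j < Suc n" for j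
    proof -
      have "col K j = a j" using carrier_vecD[OF a[of j]] j by (intro eq_vecI) (auto simp: K_def)
      then have "col (?N * K) j = a (n - p + j)"
        using col_mult2[OF N K j] pow_mat_add_vec[OF A x, of "n - p" j] by (simp add: a_def)
      then have "col (?N * K) j $ i = a (n - p + j) $ i" by simp
      then show ?thesis using A K i j by simp
    qed
    have "(\<Sum>j<Suc n. a (n - p + j) $ i * v $ j) = ((?N * K) *\<^sub>v v) $ i"
    proof -
      have "(G *\<^sub>v v) $ i = (\<Sum>j<Suc n. G $$ (i, j) * v $ j)"
        if "G \<in> carrier_mat n (Suc n)" for G
        using v(1) i that by (simp add: scalar_prod_def lessThan_atLeast0)
      from this[OF mult_carrier_mat[OF N K]] show ?thesis using NK by simp
    qed
    also have "\<dots> = 0" using assoc_mult_mat_vec[OF N K v(1)] Kv N i by simp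
    finally have "0 = (\<Sum>j<Suc n. a (n - p + j) $ i * v $ j)" by simp
    \<comment> \<open>Only \<open>j = p\<close> survives: the coefficient is zero for smaller
      \<open>j\<close>, and for larger \<open>j\<close> the exponent \<open>n - p + j\<close>
      exceeds \<open>n\<close>.\<close>
    also have "\<dots> = (\<Sum>j<Suc n. if j = p then a n $ i * v $ p else 0)"
    proof (rule sum.cong[OF refl])
      fix j assume "j \<in> {..<Suc n}"
      show "a (n - p + j) $ i * v $ j = (if j = p then a n $ i * v $ p else 0)"
        using below[of j] a0[of "n - p + j"] p(1) i by (cases j p rule: linorder_cases) auto
    qed
    also have "\<dots> = a n $ i * v $ p" using p(1) by (simp add: sum.delta)
    finally show ?thesis using p(2) by simp
  qed
  then have "a n = 0\<^sub>v n" using a[of n] by (intro eq_vecI) auto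
  then show False using nz by (simp add: a_def)
qed

text \<open>The dimension \<open>n\<close> witnesses that the minimum defining the ascent is
  attained.\<close>

lemma mat_kernel_ascent:
  assumes "A \<in> carrier_mat n n"
  shows "mat_kernel (A ^\<^sub>m ascent A) = mat_kernel (A ^\<^sub>m (ascent A + 1))"
  unfolding ascent_def by (rule LeastI, rule mat_kernel_pow_dim[OF assms])

section \<open>From finitely many powers to all powers\<close>

text \<open>To be applied with \<open>k\<close> the ascent, where \<open>l > ascent A\<close>
  supplies exactly the needed exponents up to \<open>k + 1\<close>. For these exponents
  \<open>E j\<close> is the projection onto the orthogonal complement of the kernel of
  \<open>A ^\<^sub>m j\<close>, so equal kernels force equal projections.\<close>

lemma partial_isometry_all_pows:
  fixes A :: "complex mat"
  assumes A: "A \<in> carrier_mat n n"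
    and ker: "mat_kernel (A ^\<^sub>m k) = mat_kernel (A ^\<^sub>m (k + 1))"
    and pi: "\<And>j. 1 \<le> j \<Longrightarrow> j \<le> k + 1 \<Longrightarrow> partial_isometry (A ^\<^sub>m j)"
    and j: "j \<ge> 1"
  shows "partial_isometry (A ^\<^sub>m j)"
proof -
  define E where "E j = mat_adjoint (A ^\<^sub>m j) * A ^\<^sub>m j" for j
  have Aj: "A ^\<^sub>m j \<in> carrier_mat n n" "mat_adjoint (A ^\<^sub>m j) \<in> carrier_mat n n" for j
    using A by auto
  have E: "E j \<in> carrier_mat n n" for j
    unfolding E_def by (rule mult_carrier_mat[OF Aj(2) Aj(1)])
  have Eh: "mat_adjoint (E j) = E j" for j
    using mat_adjoint_mult[OF Aj(2) Aj(1), of j j] by (simp add: E_def)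
  have cancel: "A ^\<^sub>m j * E j = A ^\<^sub>m j" if "j \<le> k + 1" for j
  proof (cases "j = 0")
    case True
    then show ?thesis using A by (simp add: E_def)
  next
    case False
    then have "A ^\<^sub>m j * mat_adjoint (A ^\<^sub>m j) * A ^\<^sub>m j = A ^\<^sub>m j"
      using that partial_isometryD[OF Aj(1)] pi by simp
    then show ?thesis using Aj[of j] by (simp add: E_def assoc_mult_mat[of _ n n _ n _ n])
  qed
  have EE: "E i * E j = E i" if "A ^\<^sub>m i * E j = A ^\<^sub>m i" for i j
    using that assoc_mult_mat[OF Aj(2) Aj(1) E, of i i j] by (simp add: E_def)
  \<comment> \<open>\<open>A ^\<^sub>m j * E j = A ^\<^sub>m j * 1\<close> is transported along the
    inclusion of kernels.\<close>
  have cross: "A ^\<^sub>m i * E j = A ^\<^sub>m i"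
    if "j \<le> k + 1" "mat_kernel (A ^\<^sub>m j) \<subseteq> mat_kernel (A ^\<^sub>m i)" for i j
    using mat_kernel_cancel_left[OF Aj(1) Aj(1) E one_carrier_mat that(2), of j] cancel[OF that(1)]
      right_mult_one_mat[OF Aj(1)[of j]] right_mult_one_mat[OF Aj(1)[of i]] by simp
  \<comment> \<open>Taking the adjoint of \<open>E (k + 1) * E k = E (k + 1)\<close> swaps the
    Hermitian factors, so the product \<open>E k * E (k + 1)\<close> equals both \<open>E k\<close>
    and \<open>E (k + 1)\<close>.\<close>
  have "E k * E (k + 1) = E k" by (intro EE cross) (use ker in auto)
  moreover have "E (k + 1) * E k = E (k + 1)" by (intro EE cross) (use ker in auto)
  ultimately have step: "E (k + 1) = E k"
    using mat_adjoint_mult[OF E E, of "k + 1" k] Eh by simp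
  have rec: "E (Suc i) = mat_adjoint A * E i * A" for i
    using A Aj[of i]
    by (simp add: E_def mat_adjoint_mult[of _ n n _ n] assoc_mult_mat[of _ n n _ n _ n]
        mult_carrier_mat[of _ n n _ n])
  have const: "E (k + i) = E k" for i
  proof (induction i)
    case (Suc i)
    then show ?case using rec[of "k + i"] rec[of k] step by simp
  qed simp
  show ?thesis
  proof (cases "j \<le> k + 1")
    case True
    then show ?thesis using pi j by simp
  next
    case False
    define i where "i = j - k"
    have ji: "j = k + i" using False by (simp add: i_def)
    have Ej: "E j = E k" unfolding ji by (rule const)
    \<comment> \<open>The right factor \<open>A ^\<^sub>m k\<close> absorbs \<open>E k\<close>,
      which is also \<open>E j\<close>; this yields the identity characterizing partial isometries
      for exponent \<open>j\<close>.\<close>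
    have "A ^\<^sub>m j = A ^\<^sub>m i * A ^\<^sub>m k" using pow_mat_add[OF A, of i k] ji by (simp add: add.commute)
    then have "A ^\<^sub>m j * E k = A ^\<^sub>m j"
      using cancel[of k] assoc_mult_mat[OF Aj(1) Aj(1) E, of i k k] by simp
    then have "A ^\<^sub>m j * mat_adjoint (A ^\<^sub>m j) * A ^\<^sub>m j = A ^\<^sub>m j"
      using Ej assoc_mult_mat[OF Aj(1) Aj(2) Aj(1), of j j j] by (simp add: E_def)
    then show ?thesis using partial_isometryI[OF Aj(1)] by blast
  qed
qed

section \<open>Direct sums and unitary similarity\<close>

lemma four_block_mat_eqD:
  assumes eq: "four_block_mat A B C D = four_block_mat A' B' C' D'"
    and c: "A \<in> carrier_mat m m" "A' \<in> carrier_mat m m" "D \<in> carrier_mat n n" "D' \<in> carrier_mat n n"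
  shows "A = A'" "D = D'"
proof -
  have e: "four_block_mat A B C D $$ (i, j) = four_block_mat A' B' C' D' $$ (i, j)" for i j
    by (simp add: eq)
  show "A = A'"
  proof (rule eq_matI)
    fix i j assume "i < dim_row A'" "j < dim_col A'"
    then show "A $$ (i, j) = A' $$ (i, j)" using e[of i j] c by simp
  qed (use c in auto)
  show "D = D'"
  proof (rule eq_matI)
    fix i j assume "i < dim_row D'" "j < dim_col D'"
    then show "D $$ (i, j) = D' $$ (i, j)" using e[of "m + i" "m + j"] c by simp
  qed (use c in auto)
qed

lemma direct_sum_mult:
  fixes A :: "complex mat"
  assumes A: "A \<in> carrier_mat m m" and D: "D \<in> carrier_mat n n"
    and B: "B \<in> carrier_mat m m" and E: "E \<in> carrier_mat n n"
  shows "four_block_mat A (0\<^sub>m m n) (0\<^sub>m n m) D * four_block_mat B (0\<^sub>m m n) (0\<^sub>m n m) E =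
    four_block_mat (A * B) (0\<^sub>m m n) (0\<^sub>m n m) (D * E)"
proof -
  have "A * B \<in> carrier_mat m m" "D * E \<in> carrier_mat n n" using assms by auto
  then show ?thesis
    using mult_four_block_mat[OF A zero_carrier_mat zero_carrier_mat D
        B zero_carrier_mat zero_carrier_mat E] A B D E
    by simp
qed

lemma direct_sum_adjoint:
  fixes A :: "complex mat"
  assumes A: "A \<in> carrier_mat m m" and D: "D \<in> carrier_mat n n"
  shows "mat_adjoint (four_block_mat A (0\<^sub>m m n) (0\<^sub>m n m) D) =
    four_block_mat (mat_adjoint A) (0\<^sub>m m n) (0\<^sub>m n m) (mat_adjoint D)"
  using mat_adjoint_four_block[OF A zero_carrier_mat zero_carrier_mat D] by simp

text \<open>The identity \<open>M M\<^sup>* M = M\<close> splits along the diagonal blocks. The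
  forward direction later passes the hypothesis on to the block that remains after a Jordan block is
  removed.\<close>

lemma partial_isometry_direct_sum:
  fixes A :: "complex mat"
  assumes A: "A \<in> carrier_mat m m" and D: "D \<in> carrier_mat n n"
  shows "partial_isometry (four_block_mat A (0\<^sub>m m n) (0\<^sub>m n m) D) \<longleftrightarrow>
    partial_isometry A \<and> partial_isometry D" (is "partial_isometry ?M \<longleftrightarrow> _")
proof -
  let ?A = "A * mat_adjoint A * A" and ?D = "D * mat_adjoint D * D"
  have M: "?M \<in> carrier_mat (m + n) (m + n)" using A D by simp
  have AD: "A * mat_adjoint A \<in> carrier_mat m m" "D * mat_adjoint D \<in> carrier_mat n n"
    "?A \<in> carrier_mat m m" "?D \<in> carrier_mat n n"
    using A D by auto
  have "?M * mat_adjoint ?M * ?M = four_block_mat ?A (0\<^sub>m m n) (0\<^sub>m n m) ?D"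
    unfolding direct_sum_adjoint[OF A D]
      direct_sum_mult[OF A D mat_adjoint_carrier[OF A] mat_adjoint_carrier[OF D]]
    by (rule direct_sum_mult[OF AD(1,2) A D])
  moreover have "four_block_mat ?A (0\<^sub>m m n) (0\<^sub>m n m) ?D = ?M \<longleftrightarrow> ?A = A \<and> ?D = D"
    using four_block_mat_eqD[of ?A _ _ ?D A _ _ D m n] A D AD by metis
  ultimately show ?thesis
    using partial_isometry_iff[OF M] partial_isometry_iff[OF A] partial_isometry_iff[OF D] by simp
qed

lemma partial_isometry_diag_block_mat:
  assumes "\<And>A. A \<in> set As \<Longrightarrow> square_mat A \<and> partial_isometry A"
  shows "partial_isometry (diag_block_mat As)"
  using assms
proof (induction As)
  case Nil
  show ?case by (rule partial_isometryI[of _ 0]) auto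
next
  case (Cons A As)
  let ?D = "diag_block_mat As"
  have "square_mat ?D" using Cons.prems by (intro diag_block_mat_square) auto
  then have D: "?D \<in> carrier_mat (dim_row ?D) (dim_row ?D)" by auto
  have A: "A \<in> carrier_mat (dim_row A) (dim_row A)" using Cons.prems[of A] by auto
  have "partial_isometry ?D" using Cons.IH Cons.prems by simp
  then have "partial_isometry
      (four_block_mat A (0\<^sub>m (dim_row A) (dim_row ?D)) (0\<^sub>m (dim_row ?D) (dim_row A)) ?D)"
    using partial_isometry_direct_sum[OF A D] Cons.prems[of A] by simp
  then show ?case
    using carrier_matD(2)[OF A] carrier_matD(2)[OF D] by (simp only: diag_block_mat.simps Let_def)
qed

section \<open>Unitary matrices and unitary similarity\<close>

lemma unitary_matD:
  assumes "unitary_mat U"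
  shows "U \<in> carrier_mat (dim_row U) (dim_row U)"
    "mat_adjoint U * U = 1\<^sub>m (dim_row U)" "U * mat_adjoint U = 1\<^sub>m (dim_row U)"
  using assms by (auto simp: unitary_mat_def)

text \<open>For square matrices a left inverse is also a right inverse.\<close>

lemma unitary_matI:
  assumes U: "U \<in> carrier_mat n n" and "mat_adjoint U * U = 1\<^sub>m n"
  shows "unitary_mat U"
  using assms mat_mult_left_right_inverse[of "mat_adjoint U" n U]
  unfolding unitary_mat_def by auto

lemma unitary_mat_one: "unitary_mat (1\<^sub>m n)"
  by (rule unitary_matI[of _ n]) auto

lemma unitary_mat_mult:
  assumes U: "U \<in> carrier_mat n n" "unitary_mat U" and V: "V \<in> carrier_mat n n" "unitary_mat V"
  shows "unitary_mat (U * V)"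
proof (rule unitary_matI[of _ n])
  have "mat_adjoint (U * V) * (U * V) = mat_adjoint V * ((mat_adjoint U * U) * V)"
    using U(1) V(1) by (simp add: mat_adjoint_mult[of _ n n _ n] assoc_mult_mat[of _ n n _ n _ n])
  then show "mat_adjoint (U * V) * (U * V) = 1\<^sub>m n"
    using unitary_matD(2)[OF U(2)] unitary_matD(2)[OF V(2)] U(1) V(1) by simp
qed (use U V in simp)

lemma unitary_mat_direct_sum:
  assumes U: "U \<in> carrier_mat m m" "unitary_mat U" and V: "V \<in> carrier_mat n n" "unitary_mat V"
  shows "unitary_mat (four_block_mat U (0\<^sub>m m n) (0\<^sub>m n m) V)" (is "unitary_mat ?M")
proof (rule unitary_matI[of _ "m + n"])
  show "mat_adjoint ?M * ?M = 1\<^sub>m (m + n)"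
    unfolding direct_sum_adjoint[OF U(1) V(1)]
      direct_sum_mult[OF mat_adjoint_carrier[OF U(1)] mat_adjoint_carrier[OF V(1)] U(1) V(1)]
    using U(1) V(1) unitary_matD(2)[OF U(2)] unitary_matD(2)[OF V(2)] by simp
qed (use U V in simp)

lemma unitary_mat_pow:
  assumes "U \<in> carrier_mat n n" "unitary_mat U"
  shows "unitary_mat (U ^\<^sub>m k)"
  using assms by (induction k) (auto intro: unitary_mat_one unitary_mat_mult[of _ n])

lemma unitary_mat_partial_isometry:
  assumes "unitary_mat U"
  shows "partial_isometry U"
  using partial_isometryI[OF unitary_matD(1)[OF assms]] unitary_matD[OF assms]
  by (metis left_mult_one_mat)

lemma partial_isometry_unitary_conj:
  fixes P B :: "complex mat"
  assumes P: "P \<in> carrier_mat n n" "mat_adjoint P * P = 1\<^sub>m n" and B: "B \<in> carrier_mat n n"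
    and pi: "partial_isometry B"
  shows "partial_isometry (P * B * mat_adjoint P)"
proof (rule partial_isometryI[of _ n])
  let ?Q = "mat_adjoint P" and ?C = "mat_adjoint B"
  have Q: "?Q \<in> carrier_mat n n" "?C \<in> carrier_mat n n" using P B by auto
  \<comment> \<open>\<open>c\<close> and \<open>BB\<close> state the cancellations with a trailing
    factor \<open>X\<close>, so that they still apply once all products are associated to the
    right.\<close>
  have c: "?Q * (P * X) = X" if "X \<in> carrier_mat n n" for X
    using assoc_mult_mat[OF Q(1) P(1) that] P(2) that by simp
  have BB: "B * (?C * (B * X)) = B * X" if X: "X \<in> carrier_mat n n" for X
    using arg_cong[OF partial_isometryD[OF B pi], of "\<lambda>M. M * X"] B Q X
    by (simp add: assoc_mult_mat[of _ n n _ n _ n])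
  show "P * B * ?Q * mat_adjoint (P * B * ?Q) * (P * B * ?Q) = P * B * ?Q"
    using P(1) B Q
    by (simp add: mat_adjoint_mult[of _ n n _ n] assoc_mult_mat[of _ n n _ n _ n]
        mult_carrier_mat[of _ n n _ n] c BB)
qed (use P B in \<open>simp add: mult_carrier_mat[of _ n n _ n]\<close>)

lemma partial_isometry_unitarily_similar:
  assumes "partial_isometry B" "similar_mat_wit A B P (mat_adjoint P)"
  shows "partial_isometry A"
proof -
  note wit = similar_mat_witD[OF refl assms(2)]
  show ?thesis
    using partial_isometry_unitary_conj[OF wit(6,2,5) assms(1)] by (simp only: wit(3)[symmetric])
qed

lemma unitarily_similar_trans:
  assumes "unitarily_similar A B" "unitarily_similar B C"
  shows "unitarily_similar A C"
proof -
  obtain P Q where P: "unitary_mat P" "similar_mat_wit A B P (mat_adjoint P)"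
    and Q: "unitary_mat Q" "similar_mat_wit B C Q (mat_adjoint Q)"
    using assms unfolding unitarily_similar_def by blast
  note PD = similar_mat_witD[OF refl P(2)]
  note QD = similar_mat_witD2[OF PD(5) Q(2)]
  have "mat_adjoint (P * Q) = mat_adjoint Q * mat_adjoint P"
    using mat_adjoint_mult[OF PD(6) QD(6)] .
  then have "similar_mat_wit A C (P * Q) (mat_adjoint (P * Q))"
    using similar_mat_wit_trans[OF P(2) Q(2)] by simp
  then show ?thesis
    using unitary_mat_mult[OF PD(6) P(1) QD(6) Q(1)] unfolding unitarily_similar_def by blast
qed

lemma unitarily_similar_direct_sum:
  assumes J: "J \<in> carrier_mat m m" and A: "A \<in> carrier_mat n n" and sim: "unitarily_similar A B"
  shows "unitarily_similar (four_block_mat J (0\<^sub>m m n) (0\<^sub>m n m) A)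
    (four_block_mat J (0\<^sub>m m n) (0\<^sub>m n m) B)"
proof -
  obtain P where P: "unitary_mat P" "similar_mat_wit A B P (mat_adjoint P)"
    using sim unfolding unitarily_similar_def by blast
  note PD = similar_mat_witD2[OF A P(2)]
  let ?P = "four_block_mat (1\<^sub>m m) (0\<^sub>m m n) (0\<^sub>m n m) P"
  have "mat_adjoint ?P = four_block_mat (1\<^sub>m m) (0\<^sub>m m n) (0\<^sub>m n m) (mat_adjoint P)"
    using direct_sum_adjoint[OF one_carrier_mat PD(6), of m] by simp
  moreover have "similar_mat_wit (four_block_mat J (0\<^sub>m m n) (0\<^sub>m n m) A)
      (four_block_mat J (0\<^sub>m m n) (0\<^sub>m n m) B) ?P
      (four_block_mat (1\<^sub>m m) (0\<^sub>m m n) (0\<^sub>m n m) (mat_adjoint P))"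
    by (rule similar_mat_wit_four_block[OF similar_mat_wit_refl[OF J] P(2) _ _ J A])
      (use PD in auto)
  moreover have "unitary_mat ?P"
    using unitary_mat_direct_sum[OF _ unitary_mat_one PD(6) P(1), of m] by simp
  ultimately show ?thesis unfolding unitarily_similar_def by metis
qed

text \<open>Conjugation by the block permutation matrix. It is needed because the induction produces
  the unitary summand last, while condition (b) lists it first.\<close>

lemma unitarily_similar_swap:
  fixes A B :: "complex mat"
  assumes A: "A \<in> carrier_mat m m" and B: "B \<in> carrier_mat n n"
  shows "unitarily_similar (four_block_mat A (0\<^sub>m m n) (0\<^sub>m n m) B)
    (four_block_mat B (0\<^sub>m n m) (0\<^sub>m m n) A)"
proof -
  let ?P = "four_block_mat (0\<^sub>m m n) (1\<^sub>m m) (1\<^sub>m n) (0\<^sub>m n m) :: complex mat"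
  let ?Q = "four_block_mat (0\<^sub>m n m) (1\<^sub>m n) (1\<^sub>m m) (0\<^sub>m m n) :: complex mat"
  have PQ: "?P \<in> carrier_mat (m + n) (m + n)" "?Q \<in> carrier_mat (m + n) (m + n)"
    by (intro carrier_matI; simp)+
  have AB: "four_block_mat A (0\<^sub>m m n) (0\<^sub>m n m) B \<in> carrier_mat (m + n) (m + n)"
    "four_block_mat B (0\<^sub>m n m) (0\<^sub>m m n) A \<in> carrier_mat (m + n) (m + n)"
    using A B by (intro carrier_matI; simp)+
  have adj: "mat_adjoint ?P = ?Q"
    by (subst mat_adjoint_four_block[OF zero_carrier_mat[of m n] one_carrier_mat
        one_carrier_mat zero_carrier_mat[of n m]]) simp
  have QP: "?Q * ?P = 1\<^sub>m (m + n)"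
    by (subst mult_four_block_mat[OF zero_carrier_mat[of n m] one_carrier_mat one_carrier_mat
        zero_carrier_mat[of m n] zero_carrier_mat[of m n] one_carrier_mat one_carrier_mat
        zero_carrier_mat[of n m]]) (simp add: add.commute)
  have "unitary_mat ?P" by (rule unitary_matI[OF PQ(1)]) (simp only: adj QP)
  moreover have "similar_mat_wit (four_block_mat A (0\<^sub>m m n) (0\<^sub>m n m) B)
    (four_block_mat B (0\<^sub>m n m) (0\<^sub>m m n) A) ?P ?Q"
  proof (rule similar_mat_witI[OF _ QP _ AB PQ])
    have "?P * four_block_mat B (0\<^sub>m n m) (0\<^sub>m m n) A = four_block_mat (0\<^sub>m m n) A B (0\<^sub>m n m)"
      using mult_four_block_mat[OF zero_carrier_mat[of m n] one_carrier_mat one_carrier_mat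
          zero_carrier_mat[of n m] B zero_carrier_mat zero_carrier_mat A] A B
      by simp
    then show "four_block_mat A (0\<^sub>m m n) (0\<^sub>m n m) B =
        ?P * four_block_mat B (0\<^sub>m n m) (0\<^sub>m m n) A * ?Q"
      using mult_four_block_mat[OF zero_carrier_mat[of m n] A B zero_carrier_mat[of n m]
          zero_carrier_mat[of n m] one_carrier_mat one_carrier_mat zero_carrier_mat[of m n]] A B
      by simp
    show "?P * ?Q = 1\<^sub>m (m + n)"
      by (rule mat_mult_left_right_inverse[OF PQ(2,1) QP])
  qed
  ultimately show ?thesis unfolding unitarily_similar_def using adj by metis
qed

section \<open>Powers of nilpotent Jordan blocks; (b) implies (c)\<close>

lemma jordan_block_zero_pow:
  "(jordan_block n (0 :: complex)) ^\<^sub>m r = mat n n (\<lambda>(i, j). if j = i + r then 1 else 0)"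
  unfolding jordan_block_pow by (rule eq_matI) (auto simp: power_0_left binomial_eq_0)

text \<open>The power is a truncated shift \<open>?J\<close>. Then
  \<open>?J * mat_adjoint ?J\<close> is the coordinate projection \<open>?D\<close> onto the nonzero
  rows of \<open>?J\<close>, so it fixes \<open>?J\<close>; for \<open>r \<ge> n\<close> both are
  zero.\<close>

lemma partial_isometry_jordan_block_pow:
  "partial_isometry ((jordan_block n (0 :: complex)) ^\<^sub>m r)"
proof (rule partial_isometryI[of _ n])
  let ?J = "mat n n (\<lambda>(i, j). if j = i + r then 1 else 0) :: complex mat"
  let ?D = "mat n n (\<lambda>(i, j). if i = j \<and> i + r < n then 1 else 0) :: complex mat"
  have "?J * mat_adjoint ?J = ?D"
  proof (rule eq_matI)
    fix i j assume "i < dim_row ?D" "j < dim_col ?D"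
    then have "(?J * mat_adjoint ?J) $$ (i, j) =
        (\<Sum>k<n. (if k = i + r then 1 else 0) * cnj (if k = j + r then 1 else 0))"
      by (simp add: scalar_prod_def lessThan_atLeast0)
    also have "\<dots> = (\<Sum>k<n. if k = i + r then (if i = j then 1 else 0) else 0)"
      by (rule sum.cong) auto
    also have "\<dots> = ?D $$ (i, j)" using \<open>i < dim_row ?D\<close> \<open>j < dim_col ?D\<close> by auto
    finally show "(?J * mat_adjoint ?J) $$ (i, j) = ?D $$ (i, j)" .
  qed auto
  moreover have "?D * ?J = ?J"
  proof (rule eq_matI)
    fix i j assume "i < dim_row ?J" "j < dim_col ?J"
    then have "(?D * ?J) $$ (i, j) =
        (\<Sum>k<n. (if i = k \<and> i + r < n then 1 else 0) * (if j = k + r then 1 else 0))"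
      by (simp add: scalar_prod_def lessThan_atLeast0)
    also have "\<dots> = (\<Sum>k<n. if k = i then (if i + r < n \<and> j = i + r then 1 else 0) else 0)"
      by (rule sum.cong) auto
    also have "\<dots> = ?J $$ (i, j)" using \<open>i < dim_row ?J\<close> \<open>j < dim_col ?J\<close> by auto
    finally show "(?D * ?J) $$ (i, j) = ?J $$ (i, j)" .
  qed auto
  ultimately show "jordan_block n 0 ^\<^sub>m r * mat_adjoint (jordan_block n 0 ^\<^sub>m r) *
      jordan_block n 0 ^\<^sub>m r = (jordan_block n 0 ^\<^sub>m r :: complex mat)"
    unfolding jordan_block_zero_pow by simp
qed simp

text \<open>A power of a block sum is the block sum of the powers, and each summand stays a partial
  isometry.\<close>

lemma partial_isometry_pow_unitary_jordan_sum:
  assumes U: "unitary_mat U"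
    and sim: "unitarily_similar A (diag_block_mat (U # map (\<lambda>k. jordan_block k 0) ks))"
  shows "partial_isometry (A ^\<^sub>m j)"
proof -
  let ?Bs = "U # map (\<lambda>k. jordan_block k 0) ks"
  obtain P where wit: "similar_mat_wit A (diag_block_mat ?Bs) P (mat_adjoint P)"
    using sim unfolding unitarily_similar_def by blast
  have sq: "square_mat U" using U by (simp add: unitary_mat_def)
  then have "Ball (set ?Bs) square_mat" by auto
  then have "diag_block_mat ?Bs ^\<^sub>m j = diag_block_mat (map (\<lambda>B. B ^\<^sub>m j) ?Bs)"
    by (rule diag_block_pow_mat)
  moreover have "partial_isometry (diag_block_mat (map (\<lambda>B. B ^\<^sub>m j) ?Bs))"
    using unitary_mat_partial_isometry[OF unitary_mat_pow[OF unitary_matD(1)[OF U] U]]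
      partial_isometry_jordan_block_pow sq
    by (intro partial_isometry_diag_block_mat) auto
  ultimately show ?thesis
    using partial_isometry_unitarily_similar[OF _ similar_mat_wit_pow[OF wit]] by simp
qed

section \<open>Orthonormal families\<close>

text \<open>A family is a function of which only the values below \<open>m\<close> count, so it can
  be prolonged by the update \<open>f(m := x)\<close>.\<close>

definition orthonormal :: "nat \<Rightarrow> (nat \<Rightarrow> complex vec) \<Rightarrow> nat \<Rightarrow> bool" where
  "orthonormal n f m \<longleftrightarrow> (\<forall>i<m. f i \<in> carrier_vec n) \<and>
     (\<forall>i<m. \<forall>j<m. f i \<bullet>c f j = (if i = j then 1 else 0))"

lemma orthonormalD:
  assumes "orthonormal n f m"
  shows "i < m \<Longrightarrow> f i \<in> carrier_vec n"
    "i < m \<Longrightarrow> j < m \<Longrightarrow> f i \<bullet>c f j = (if i = j then 1 else 0)"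
  using assms by (auto simp: orthonormal_def)

lemma exists_unit_multiple:
  fixes v :: "complex vec"
  assumes v: "v \<in> carrier_vec n" "v \<noteq> 0\<^sub>v n"
  obtains c where "(c \<cdot>\<^sub>v v) \<bullet>c (c \<cdot>\<^sub>v v) = 1"
proof -
  define r where "r = Re (v \<bullet>c v)"
  have "v \<bullet>c v > 0" using v by simp
  then have r: "r > 0" "v \<bullet>c v = of_real r"
    by (auto simp: r_def less_complex_def complex_eq_iff)
  define c where "c = complex_of_real (1 / sqrt r)"
  have "c * c * of_real r = 1"
    using r(1) by (simp add: c_def flip: of_real_mult)
  then have "(c \<cdot>\<^sub>v v) \<bullet>c (c \<cdot>\<^sub>v v) = 1"
    using r(2) by (simp add: conjugate_smult_vec c_def mult_ac)
  then show ?thesis by (rule that)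
qed

text \<open>Orthogonality to \<open>m < n\<close> vectors is a homogeneous system with fewer
  equations than unknowns; a nonzero solution is then normalized.\<close>

lemma orthonormal_extend:
  assumes f: "orthonormal n f m" and "m < n"
  shows "\<exists>x. orthonormal n (f(m := x)) (Suc m)"
proof -
  obtain v where v: "v \<in> carrier_vec n" "v \<noteq> 0\<^sub>v n"
    and orth: "\<And>i. i < m \<Longrightarrow> (\<Sum>j<n. conjugate (f i) $ j * v $ j) = 0"
    \<comment> \<open>The system is bilinear, so its rows must be the conjugates of the
      \<open>f i\<close>.\<close>
    using wide_system_nontrivial[OF \<open>m < n\<close>, of "\<lambda>i. conjugate (f i)"] by blast
  obtain c where c: "(c \<cdot>\<^sub>v v) \<bullet>c (c \<cdot>\<^sub>v v) = 1" using exists_unit_multiple[OF v] .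
  define x where "x = c \<cdot>\<^sub>v v"
  have x: "x \<in> carrier_vec n" "x \<bullet>c x = 1" using v c by (simp_all add: x_def)
  have xf: "x \<bullet>c f i = 0" if i: "i < m" for i
  proof -
    have fi: "f i \<in> carrier_vec n" using orthonormalD(1)[OF f i] .
    have "v \<bullet>c f i = conjugate (f i) \<bullet> v" using v(1) fi by (rule conjugate_vec_sprod_comm)
    also have "\<dots> = 0" using orth[OF i] v(1) by (simp add: scalar_prod_def lessThan_atLeast0)
    finally show ?thesis using v(1) fi by (simp add: x_def)
  qed
  have "f i \<bullet>c x = 0" if i: "i < m" for i
    using cscalar_prod_commute[OF orthonormalD(1)[OF f i] x(1)] xf[OF i] by simp
  then have "orthonormal n (f(m := x)) (Suc m)"
    using x xf f unfolding orthonormal_def by (auto simp: less_Suc_eq)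
  then show ?thesis by blast
qed

lemma orthonormal_complete:
  assumes "orthonormal n f m" "m \<le> n"
  shows "\<exists>g. (\<forall>i<m. g i = f i) \<and> orthonormal n g n"
  using assms
proof (induction "n - m" arbitrary: f m)
  case 0
  then show ?case by auto
next
  case (Suc d)
  then obtain x where x: "orthonormal n (f(m := x)) (Suc m)"
    using orthonormal_extend[of n f m] by force
  have "d = n - Suc m" "Suc m \<le> n" using Suc(2) by auto
  then obtain g where "\<forall>i<Suc m. g i = (f(m := x)) i" "orthonormal n g n"
    using Suc(1)[OF _ x] by blast
  then show ?case by (intro exI[of _ g]) auto
qed

text \<open>The column and row facts allow the entries of \<open>P\<^sup>* A P\<close> to be read
  off as inner products \<open>(A g j) \<bullet>c g i\<close>.\<close>

lemma orthonormal_unitary_mat: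
  assumes g: "orthonormal n g n"
  defines "P \<equiv> mat n n (\<lambda>(i, j). g j $ i)"
  shows "unitary_mat P" "\<And>j. j < n \<Longrightarrow> col P j = g j"
    "\<And>x i. x \<in> carrier_vec n \<Longrightarrow> i < n \<Longrightarrow> row (mat_adjoint P) i \<bullet> x = x \<bullet>c g i"
proof -
  show colP: "col P j = g j" if "j < n" for j
    using carrier_vecD[OF orthonormalD(1)[OF g that]] that by (intro eq_vecI) (auto simp: P_def)
  have P: "P \<in> carrier_mat n n" by (simp add: P_def)
  show row: "row (mat_adjoint P) i \<bullet> x = x \<bullet>c g i" if x: "x \<in> carrier_vec n" and i: "i < n" for x i
  proof -
    have gi: "g i \<in> carrier_vec n" using orthonormalD(1)[OF g i] .
    have "row (mat_adjoint P) i = conjugate (g i)"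
      using carrier_vecD[OF gi] i by (intro eq_vecI) (auto simp: P_def)
    then show ?thesis using conjugate_vec_sprod_comm[OF x gi] by simp
  qed
  have "mat_adjoint P * P = 1\<^sub>m n"
  proof (rule eq_matI)
    fix i j assume "i < dim_row (1\<^sub>m n :: complex mat)" "j < dim_col (1\<^sub>m n :: complex mat)"
    then have ij: "i < n" "j < n" by auto
    have "(mat_adjoint P * P) $$ (i, j) = row (mat_adjoint P) i \<bullet> col P j"
      using P ij by (intro index_mult_mat(1)) auto
    also have "\<dots> = g j \<bullet>c g i"
      using row[OF orthonormalD(1)[OF g ij(2)] ij(1)] colP[OF ij(2)] by simp
    finally show "(mat_adjoint P * P) $$ (i, j) = 1\<^sub>m n $$ (i, j)"
      using orthonormalD(2)[OF g ij(2,1)] ij by auto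
  qed (use P in auto)
  then show "unitary_mat P" by (rule unitary_matI[OF P])
qed

text \<open>Otherwise the first \<open>n\<close> vectors are the columns of a unitary
  \<open>P\<close>. The next vector is orthogonal to all of them, so \<open>P\<^sup>*\<close>
  annihilates it and it is zero, although it has norm 1.\<close>

lemma orthonormal_le_dim:
  assumes f: "orthonormal n f m"
  shows "m \<le> n"
proof (rule ccontr)
  assume "\<not> m \<le> n"
  then have nm: "n < m" by simp
  then have g: "orthonormal n f n" using f by (auto simp: orthonormal_def)
  define P where "P = mat n n (\<lambda>(i, j). f j $ i)"
  note U = orthonormal_unitary_mat[OF g, folded P_def]
  have P: "P \<in> carrier_mat n n" by (simp add: P_def)
  let ?x = "f n"
  have x: "?x \<in> carrier_vec n" using orthonormalD(1)[OF f nm] .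
  have "mat_adjoint P *\<^sub>v ?x = 0\<^sub>v n"
  proof (rule eq_vecI)
    fix i assume "i < dim_vec (0\<^sub>v n :: complex vec)"
    then have i: "i < n" by simp
    then show "(mat_adjoint P *\<^sub>v ?x) $ i = 0\<^sub>v n $ i"
      using U(3)[OF x i] orthonormalD(2)[OF f nm, of i] nm P by simp
  qed (use P in simp)
  moreover have "P *\<^sub>v (mat_adjoint P *\<^sub>v ?x) = ?x"
    using assoc_mult_mat_vec[OF P mat_adjoint_carrier[OF P] x] unitary_matD(3)[OF U(1)] P x by simp
  ultimately have "?x = 0\<^sub>v n" using P by simp
  then show False using orthonormalD(2)[OF f nm nm] by simp
qed

section \<open>Splitting off a Jordan block\<close>

text \<open>\<open>A A\<^sup>*\<close> is an orthogonal projection, and a vector whose norm it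
  preserves is fixed. With \<open>z = A A\<^sup>* v\<close>, all four inner products in the
  expansion of \<open>(z - v) \<bullet>c (z - v)\<close> equal
  \<open>v \<bullet>c v\<close>.\<close>

lemma partial_isometry_fix:
  fixes A :: "complex mat"
  assumes A: "A \<in> carrier_mat n n" "partial_isometry A" and v: "v \<in> carrier_vec n"
    and norm: "(mat_adjoint A *\<^sub>v v) \<bullet>c (mat_adjoint A *\<^sub>v v) = v \<bullet>c v"
  shows "A *\<^sub>v (mat_adjoint A *\<^sub>v v) = v"
proof -
  let ?w = "mat_adjoint A *\<^sub>v v"
  have w: "?w \<in> carrier_vec n" using A v by simp
  define z where "z = A *\<^sub>v ?w"
  have z: "z \<in> carrier_vec n" using A w by (simp add: z_def)
  have zv: "z \<bullet>c v = v \<bullet>c v"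
    using cscalar_prod_adjoint[OF A(1) w v] norm by (simp add: z_def)
  have "z \<bullet>c z = ?w \<bullet>c (mat_adjoint A *\<^sub>v z)"
    using cscalar_prod_adjoint[OF A(1) w z] by (simp add: z_def)
  also have "mat_adjoint A *\<^sub>v z = ?w"
    using partial_isometry_mult_vec[OF _ partial_isometry_adjoint[OF A] v] A(1)
    by (simp add: z_def)
  finally have zz: "z \<bullet>c z = v \<bullet>c v" using norm by simp
  have vz: "v \<bullet>c z = v \<bullet>c v"
    using cscalar_prod_commute[OF v z] cscalar_prod_commute[OF v v] zv by simp
  have "(z - v) \<bullet>c (z - v) = 0"
    using z v zv vz zz
    by (simp add: conjugate_minus_vec[of _ n] scalar_prod_minus_distrib[of _ n]
        minus_scalar_prod_distrib[of _ n])
  then have "z - v = 0\<^sub>v n" using conjugate_square_eq_0_vec[of "z - v" n] z v by simp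
  then show ?thesis using vec_eqI_minus[OF z v] by (simp add: z_def)
qed

text \<open>With the projections \<open>E = A\<^sup>* A\<close> and \<open>F = B B\<^sup>*\<close>, the partial isometry condition for \<open>A B\<close>
  says that \<open>E F\<close> is idempotent. Hence \<open>v = E F y\<close> satisfies \<open>E F v = v\<close>, so \<open>F v = v\<close>.\<close>

lemma partial_isometry_mult_kernel:
  fixes A B :: "complex mat"
  assumes A: "A \<in> carrier_mat n n" "partial_isometry A"
    and B: "B \<in> carrier_mat n n" "partial_isometry B"
    and AB: "partial_isometry (A * B)"
    and y: "y \<in> carrier_vec n" "A *\<^sub>v y = 0\<^sub>v n"
  shows "A *\<^sub>v (B *\<^sub>v (mat_adjoint B *\<^sub>v y)) = 0\<^sub>v n"
proof -
  let ?A = "mat_adjoint A" and ?B = "mat_adjoint B"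
  have C: "?A \<in> carrier_mat n n" "?B \<in> carrier_mat n n" using A B by auto
  define u where "u = B *\<^sub>v (?B *\<^sub>v y)"
  define v where "v = ?A *\<^sub>v (A *\<^sub>v u)"
  define z where "z = B *\<^sub>v (?B *\<^sub>v v)"
  have uvz: "u \<in> carrier_vec n" "v \<in> carrier_vec n" "z \<in> carrier_vec n"
    using A(1) B(1) C y(1) by (simp_all add: u_def v_def z_def)
  have Bv: "?B *\<^sub>v v \<in> carrier_vec n" "?B *\<^sub>v y \<in> carrier_vec n" "A *\<^sub>v u \<in> carrier_vec n"
    using A(1) C uvz y by simp_all
  have Av: "A *\<^sub>v v = A *\<^sub>v u"
    unfolding v_def by (rule partial_isometry_mult_vec[OF A uvz(1)])
  have "(A * B) *\<^sub>v (mat_adjoint (A * B) *\<^sub>v ((A * B) *\<^sub>v (?B *\<^sub>v y))) = (A * B) *\<^sub>v (?B *\<^sub>v y)"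
    using partial_isometry_mult_vec[OF mult_carrier_mat[OF A(1) B(1)] AB] C y(1) by simp
  \<comment> \<open>With \<open>u = F y\<close>, \<open>v = E u\<close> and \<open>z = F v\<close>,
    the identity for \<open>A * B\<close> reads \<open>A F E F y = A F y\<close>.\<close>
  then have Az: "A *\<^sub>v z = A *\<^sub>v u"
    using A(1) B(1) C y(1)
    by (simp add: z_def v_def u_def mat_adjoint_mult[of _ n n _ n] assoc_mult_mat_vec[of _ n n _ n])
  have Ev: "x \<bullet>c v = (A *\<^sub>v x) \<bullet>c (A *\<^sub>v u)" if "x \<in> carrier_vec n" for x
    using cscalar_prod_adjoint[OF A(1) that Bv(3)] by (simp add: v_def)
  have "(?B *\<^sub>v v) \<bullet>c (?B *\<^sub>v v) = z \<bullet>c v"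
    using cscalar_prod_adjoint[OF B(1) Bv(1) uvz(2)] by (simp add: z_def)
  also have "\<dots> = v \<bullet>c v" using Ev uvz Az Av by simp
  finally have "z = v" unfolding z_def by (rule partial_isometry_fix[OF B uvz(2)])
  \<comment> \<open>Since \<open>F\<close> is Hermitian and fixes \<open>v\<close>, the inner
    product of \<open>u = F y\<close> with \<open>v\<close> is that of \<open>y\<close> with
    \<open>v = E u\<close>, which vanishes because \<open>A y = 0\<close>.\<close>
  have "v \<bullet>c v = u \<bullet>c v" using Ev uvz Av by simp
  also have "\<dots> = (?B *\<^sub>v y) \<bullet>c (?B *\<^sub>v v)"
    using cscalar_prod_adjoint[OF B(1) Bv(2) uvz(2)] by (simp add: u_def)
  also have "\<dots> = y \<bullet>c z"
    using cscalar_prod_adjoint'[OF B(1) y(1) Bv(1)] by (simp add: z_def)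
  also have "\<dots> = 0" using Ev[OF y(1)] \<open>z = v\<close> y Bv(3) by simp
  finally have "v = 0\<^sub>v n" using conjugate_square_eq_0_vec[OF uvz(2)] by simp
  then show ?thesis using Av A(1) by (simp add: u_def)
qed

text \<open>The ascent is \<open>Suc k\<close>, so the chain has indices \<open>0\<close> to
  \<open>k\<close> and starts at \<open>f 0 = y\<close> in the range of
  \<open>A ^\<^sub>m k\<close>. The adjoint moves up the chain and \<open>A\<close> moves down; both
  end at zero, which makes the span reducing.\<close>

lemma exists_jordan_chain:
  fixes A :: "complex mat"
  assumes A: "A \<in> carrier_mat n n"
    and pi: "\<And>j. 1 \<le> j \<Longrightarrow> partial_isometry (A ^\<^sub>m j)"
    and asc: "ascent A = Suc k"
  shows "\<exists>f. orthonormal n f (Suc k) \<and>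
    A *\<^sub>v f 0 = 0\<^sub>v n \<and> (\<forall>j<k. A *\<^sub>v f (Suc j) = f j) \<and>
    (\<forall>j<k. mat_adjoint A *\<^sub>v f j = f (Suc j)) \<and> mat_adjoint A *\<^sub>v f k = 0\<^sub>v n"
proof -
  let ?B = "mat_adjoint A"
  have B: "?B \<in> carrier_mat n n" using A by simp
  have Aj: "A ^\<^sub>m j \<in> carrier_mat n n" and Bj: "?B ^\<^sub>m j \<in> carrier_mat n n" for j
    using A B by simp_all
  have adj: "mat_adjoint (A ^\<^sub>m j) = ?B ^\<^sub>m j" for j by (rule mat_adjoint_pow[OF A])
  have p1: "A ^\<^sub>m 1 = A" using A by simp
  have A1: "partial_isometry A" using pi[of 1] p1 by simp
  \<comment> \<open>The exponent \<open>k\<close> lies below the minimum \<open>Suc k\<close>, so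
    the kernels still grow there.\<close>
  have "mat_kernel (A ^\<^sub>m k) \<noteq> mat_kernel (A ^\<^sub>m (k + 1))"
    using not_less_Least[of k "\<lambda>k. mat_kernel (A ^\<^sub>m k) = mat_kernel (A ^\<^sub>m (k + 1))"] asc
    by (simp add: ascent_def)
  then obtain x where "x \<in> mat_kernel (A ^\<^sub>m (k + 1))" and nx: "x \<notin> mat_kernel (A ^\<^sub>m k)"
    using mat_kernel_pow_Suc_subset[OF A, of k] by blast
  then have x: "x \<in> carrier_vec n" and zero: "A ^\<^sub>m (k + 1) *\<^sub>v x = 0\<^sub>v n"
    using mat_kernelD[OF Aj] by blast+
  have nz: "A ^\<^sub>m k *\<^sub>v x \<noteq> 0\<^sub>v n"
    using nx x mat_kernelI[OF Aj, of x k] by blast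
  have xk: "A ^\<^sub>m k *\<^sub>v x \<in> carrier_vec n" using Aj x by simp
  obtain c where c: "(c \<cdot>\<^sub>v (A ^\<^sub>m k *\<^sub>v x)) \<bullet>c (c \<cdot>\<^sub>v (A ^\<^sub>m k *\<^sub>v x)) = 1"
    using exists_unit_multiple[OF xk nz] .
  define x' where "x' = c \<cdot>\<^sub>v x"
  define y where "y = A ^\<^sub>m k *\<^sub>v x'"
  have x': "x' \<in> carrier_vec n" using x by (simp add: x'_def)
  have y: "y \<in> carrier_vec n" using Aj x' by (simp add: y_def)
  have y1: "y \<bullet>c y = 1" using c mult_mat_vec[OF Aj x, of k c] by (simp add: y_def x'_def)
  have "A ^\<^sub>m (k + 1) *\<^sub>v x' = 0\<^sub>v n"
    using mult_mat_vec[OF Aj x, of "k + 1" c] unfolding zero x'_def by (auto simp del: pow_mat.simps)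
  then have Ay: "A *\<^sub>v y = 0\<^sub>v n"
    using pow_mat_add_vec[OF A x', of 1 k] A by (simp add: y_def)
  define f where "f j = ?B ^\<^sub>m j *\<^sub>v y" for j
  have f: "f j \<in> carrier_vec n" for j using Bj y by (simp add: f_def)
  have fSuc: "?B *\<^sub>v f j = f (Suc j)" for j
    using pow_mat_add_vec[OF B y, of 1 j] B by (simp add: f_def)
  \<comment> \<open>\<open>y\<close> lies in the range of \<open>A ^\<^sub>m j\<close> for
    \<open>j \<le> k\<close>, and \<open>A ^\<^sub>m j\<close> times its adjoint acts as the
    identity on that range.\<close>
  have ret: "A ^\<^sub>m j *\<^sub>v f j = y" if "j \<le> k" for j
  proof (cases "j = 0")
    case True
    then show ?thesis using A B y by (simp add: f_def)
  next
    case False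
    have "y = A ^\<^sub>m j *\<^sub>v (A ^\<^sub>m (k - j) *\<^sub>v x')"
      using pow_mat_add_vec[OF A x', of j "k - j"] that by (simp add: y_def)
    moreover have "A ^\<^sub>m (k - j) *\<^sub>v x' \<in> carrier_vec n" using Aj x' by simp
    ultimately show ?thesis
      using partial_isometry_mult_vec[OF Aj pi, of j "A ^\<^sub>m (k - j) *\<^sub>v x'"] False
      by (simp add: f_def adj)
  qed
  have inner: "f i \<bullet>c f j = (A ^\<^sub>m j *\<^sub>v f i) \<bullet>c y" for i j
    using cscalar_prod_adjoint[OF Aj f y, of j i] by (simp add: f_def adj)
  have unit: "f j \<bullet>c f j = 1" if "j \<le> k" for j using inner ret[OF that] y1 by simp
  \<comment> \<open>For \<open>i < j\<close>, \<open>A ^\<^sub>m j\<close> first brings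
    \<open>f i\<close> down to \<open>y\<close>, and at least one factor \<open>A\<close> is left to
    annihilate it.\<close>
  have orth: "f i \<bullet>c f j = 0" if "i < j" "j \<le> k" for i j
  proof -
    have "A ^\<^sub>m j *\<^sub>v f i = A ^\<^sub>m (j - i) *\<^sub>v (A ^\<^sub>m i *\<^sub>v f i)"
      using pow_mat_add_vec[OF A f, of "j - i" i i] that by simp
    also have "\<dots> = A ^\<^sub>m (j - i - 1) *\<^sub>v (A *\<^sub>v y)"
    proof -
      have "j - i = j - i - 1 + 1" using that by simp
      then have "A ^\<^sub>m (j - i) *\<^sub>v y = A ^\<^sub>m (j - i - 1) *\<^sub>v (A *\<^sub>v y)"
        using pow_mat_add_vec[OF A y, of "j - i - 1" 1, unfolded p1] by (simp only:)
      then show ?thesis using ret[of i] that by simp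
    qed
    finally show ?thesis using inner[of i j] Ay mult_mat_vec_zero[OF Aj] y by simp
  qed
  have "f i \<bullet>c f j = (if i = j then 1 else 0)" if "i \<le> k" "j \<le> k" for i j
    using unit orth that cscalar_prod_commute[OF f f, of i j]
    by (cases i j rule: linorder_cases) auto
  then have on: "orthonormal n f (Suc k)" using f by (simp add: orthonormal_def less_Suc_eq_le)
  \<comment> \<open>\<open>f j\<close> and its image \<open>f (Suc j)\<close> under the adjoint both
    have norm 1, so \<open>partial_isometry_fix\<close> applies.\<close>
  have Af: "A *\<^sub>v f (Suc j) = f j" if "j < k" for j
  proof -
    have "(?B *\<^sub>v f j) \<bullet>c (?B *\<^sub>v f j) = f j \<bullet>c f j"
      using unit[of j] unit[of "Suc j"] that fSuc by simp
    from partial_isometry_fix[OF A A1 f this] show ?thesis using fSuc by simp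
  qed
  let ?u = "?B ^\<^sub>m Suc k *\<^sub>v y"
  have u: "?u \<in> carrier_vec n" using mult_mat_vec_carrier[OF Bj y] .
  \<comment> \<open>The chain stops at \<open>k\<close>: \<open>partial_isometry_mult_kernel\<close>
    for this product puts \<open>?u\<close> into the kernel of the power \<open>Suc k + 1\<close>,
    which by the ascent is the kernel of the power \<open>Suc k\<close>. Then \<open>inner\<close>
    gives \<open>f (Suc k)\<close> norm zero.\<close>
  have "partial_isometry (A * A ^\<^sub>m Suc k)"
    using pi[of "Suc (Suc k)"] pow_mat_Suc_left[OF A, of "Suc k"] by simp
  then have "A *\<^sub>v (A ^\<^sub>m Suc k *\<^sub>v ?u) = 0\<^sub>v n"
    using partial_isometry_mult_kernel[OF A A1 Aj pi _ y Ay, of "Suc k"] adj[of "Suc k"] by simp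
  then have "A ^\<^sub>m (Suc k + 1) *\<^sub>v ?u = 0\<^sub>v n"
    using pow_mat_add_vec[OF A u, of 1 "Suc k"] A by simp
  then have "?u \<in> mat_kernel (A ^\<^sub>m Suc k)"
    using mat_kernel_ascent[OF A] asc mat_kernelI[OF Aj u, of "Suc k + 1"] by simp
  then have "A ^\<^sub>m Suc k *\<^sub>v f (Suc k) = 0\<^sub>v n" using mat_kernelD(2)[OF Aj] by (simp only: f_def)
  then have "f (Suc k) \<bullet>c f (Suc k) = 0" using inner y by simp
  then have "f (Suc k) = 0\<^sub>v n" using conjugate_square_eq_0_vec[OF f] by blast
  then have "?B *\<^sub>v f k = 0\<^sub>v n" using fSuc by simp
  moreover have "f 0 = y" using A y by (simp add: f_def)
  ultimately show ?thesis using on Af fSuc Ay by (intro exI[of _ f]) auto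
qed

text \<open>The chain is completed to an orthonormal basis, and \<open>D\<close> is the matrix of
  \<open>A\<close> in that basis. Invariance of the span under \<open>A\<close> clears the lower
  left block, invariance under the adjoint the upper right one.\<close>

lemma split_off_jordan_block:
  fixes A :: "complex mat"
  assumes A: "A \<in> carrier_mat n n"
    and pi: "\<And>j. 1 \<le> j \<Longrightarrow> partial_isometry (A ^\<^sub>m j)"
    and asc: "ascent A = Suc k"
  shows "\<exists>m C P. n = Suc k + m \<and> C \<in> carrier_mat m m \<and> unitary_mat P \<and>
    similar_mat_wit A (four_block_mat (jordan_block (Suc k) 0) (0\<^sub>m (Suc k) m) (0\<^sub>m m (Suc k)) C)
      P (mat_adjoint P)"
proof -
  obtain f where f: "orthonormal n f (Suc k)" and f0: "A *\<^sub>v f 0 = 0\<^sub>v n"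
    and Af: "\<And>j. j < k \<Longrightarrow> A *\<^sub>v f (Suc j) = f j"
    and Bf: "\<And>j. j < k \<Longrightarrow> mat_adjoint A *\<^sub>v f j = f (Suc j)"
    and Bfk: "mat_adjoint A *\<^sub>v f k = 0\<^sub>v n"
    using exists_jordan_chain[OF A pi asc] by blast
  let ?p = "Suc k"
  have pn: "?p \<le> n" using orthonormal_le_dim[OF f] .
  then obtain m where n: "n = ?p + m" using le_Suc_ex by blast
  obtain g where gf: "\<And>i. i < ?p \<Longrightarrow> g i = f i" and g: "orthonormal n g n"
    using orthonormal_complete[OF f pn] by blast
  note gD = orthonormalD[OF g]
  define P where "P = mat n n (\<lambda>(i, j). g j $ i)"
  note U = orthonormal_unitary_mat[OF g, folded P_def]
  have P: "P \<in> carrier_mat n n" by (simp add: P_def)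
  let ?Q = "mat_adjoint P"
  have Q: "?Q \<in> carrier_mat n n" using P by simp
  have PQ: "P * ?Q = 1\<^sub>m n" "?Q * P = 1\<^sub>m n" using unitary_matD[OF U(1)] P by auto
  define D where "D = ?Q * (A * P)"
  have D: "D \<in> carrier_mat n n" unfolding D_def by (rule mult_carrier_mat[OF Q mult_carrier_mat[OF A P]])
  have Dij: "D $$ (i, j) = (A *\<^sub>v g j) \<bullet>c g i" if ij: "i < n" "j < n" for i j
  proof -
    have "D $$ (i, j) = row ?Q i \<bullet> col (A * P) j"
      unfolding D_def using A P ij by (intro index_mult_mat(1)) auto
    also have "col (A * P) j = A *\<^sub>v g j" using col_mult2[OF A P ij(2)] U(2)[OF ij(2)] by simp
    also have "row ?Q i \<bullet> (A *\<^sub>v g j) = (A *\<^sub>v g j) \<bullet>c g i"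
      using A gD(1)[OF ij(2)] by (intro U(3)[OF _ ij(1)]) simp
    finally show ?thesis .
  qed
  define C where "C = mat m m (\<lambda>(i, j). D $$ (?p + i, ?p + j))"
  have C: "C \<in> carrier_mat m m" by (simp add: C_def)
  let ?M = "four_block_mat (jordan_block ?p 0) (0\<^sub>m ?p m) (0\<^sub>m m ?p) C"
  have M: "?M \<in> carrier_mat n n" unfolding n by (rule four_block_carrier_mat[OF jordan_block_carrier C])
  have "D = ?M"
  proof (rule eq_matI)
    fix i j assume "i < dim_row ?M" "j < dim_col ?M"
    then have ij: "i < n" "j < n" using M by auto
    have gij: "g i \<in> carrier_vec n" "g j \<in> carrier_vec n" using gD(1) ij by auto
    have Mij: "?M $$ (i, j) = (if i < ?p
        then if j < ?p then if Suc i = j then 1 else 0 else 0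
        else if j < ?p then 0 else C $$ (i - ?p, j - ?p))"
      using ij C n by auto
    consider (left) "j < ?p" | (right) "\<not> j < ?p" "i < ?p" | (rest) "\<not> j < ?p" "\<not> i < ?p"
      by blast
    then show "D $$ (i, j) = ?M $$ (i, j)"
    proof cases
      \<comment> \<open>The first columns come from \<open>A f 0 = 0\<close> and
        \<open>A f (Suc j) = f j\<close>, which is the superdiagonal of the Jordan block.\<close>
      case left
      show ?thesis
      proof (cases j)
        case 0
        then have "D $$ (i, j) = 0" using Dij[OF ij] f0 gf[of 0] gij by simp
        then show ?thesis unfolding Mij using left 0 by auto
      next
        case (Suc j')
        then have j': "j' < k" "g j = f (Suc j')" "f j' = g j'" using left gf[of j] gf[of j'] by auto
        then have "D $$ (i, j) = (if j' = i then 1 else 0)"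
          using Dij[OF ij] Af[of j'] gD(2)[of j' i] ij n by simp
        then show ?thesis unfolding Mij using left Suc j'(1) by auto
      qed
    next
      \<comment> \<open>\<open>A\<close> is moved to the other side: its adjoint maps
        \<open>f i\<close> to \<open>f (Suc i)\<close> or to zero, hence to something orthogonal to
        \<open>g j\<close>.\<close>
      case right
      have "D $$ (i, j) = g j \<bullet>c (mat_adjoint A *\<^sub>v f i)"
        using Dij[OF ij] cscalar_prod_adjoint[OF A gij(2,1)] gf[OF right(2)] by simp
      also have "\<dots> = 0"
      proof (cases "i < k")
        case True
        then show ?thesis using Bf[OF True] gf[of "Suc i"] gD(2)[of j "Suc i"] right ij n by auto
      next
        case False
        then have "i = k" using right by simp
        then show ?thesis using Bfk gij by simp
      qed
      finally show ?thesis unfolding Mij using right by simp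
    next
      case rest
      then show ?thesis unfolding Mij using ij n by (simp add: C_def)
    qed
  qed (use D M in auto)
  have "P * D * ?Q = (P * ?Q) * (A * (P * ?Q))"
    unfolding D_def using P Q A
    by (simp add: assoc_mult_mat[of _ n n _ n _ n] mult_carrier_mat[of _ n n _ n])
  then have "A = P * ?M * ?Q" using A by (simp add: PQ(1) \<open>D = ?M\<close>)
  then have "similar_mat_wit A ?M P ?Q" by (rule similar_mat_witI[OF PQ _ A M P Q])
  then show ?thesis using n C U(1) by blast
qed

section \<open>Ascent under similarity and for direct summands\<close>

text \<open>\<open>P\<close> is injective and intertwines the powers,
  \<open>A ^\<^sub>m k * P = P * B ^\<^sub>m k\<close>, so it carries kernel vectors of
  \<open>B\<close>-powers to kernel vectors of \<open>A\<close>-powers and back.\<close>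

lemma mat_kernel_pow_similar:
  assumes wit: "similar_mat_wit A B P Q" and A: "A \<in> carrier_mat n n"
    and ker: "mat_kernel (A ^\<^sub>m i) \<subseteq> mat_kernel (A ^\<^sub>m j)"
  shows "mat_kernel (B ^\<^sub>m i) \<subseteq> mat_kernel (B ^\<^sub>m j)"
proof
  note D = similar_mat_witD2[OF A wit]
  have Ak: "A ^\<^sub>m k \<in> carrier_mat n n" and Bk: "B ^\<^sub>m k \<in> carrier_mat n n" for k
    using A D(5) by auto
  fix x assume x: "x \<in> mat_kernel (B ^\<^sub>m i)"
  note xD = mat_kernelD[OF Bk x]
  have Px: "P *\<^sub>v x \<in> carrier_vec n" using D(6) xD(1) by simp
  have AP: "A ^\<^sub>m k *\<^sub>v (P *\<^sub>v x) = P *\<^sub>v (B ^\<^sub>m k *\<^sub>v x)" for k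
  proof -
    have "A ^\<^sub>m k *\<^sub>v (P *\<^sub>v x) = P *\<^sub>v (B ^\<^sub>m k *\<^sub>v ((Q * P) *\<^sub>v x))"
      using similar_mat_wit_pow_id[OF wit, of k] Bk[of k] D(6,7) xD(1) Px
      by (simp add: assoc_mult_mat_vec[of _ n n _ n] mult_carrier_mat[of _ n n _ n])
    then show ?thesis using D(2) xD(1) by simp
  qed
  have "A ^\<^sub>m i *\<^sub>v (P *\<^sub>v x) = 0\<^sub>v n" using AP xD(2) D(6) by simp
  then have "P *\<^sub>v x \<in> mat_kernel (A ^\<^sub>m j)" using ker mat_kernelI[OF Ak Px] by blast
  then have "P *\<^sub>v (B ^\<^sub>m j *\<^sub>v x) = 0\<^sub>v n" using mat_kernelD(2)[OF Ak] AP by metis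
  then have "(Q * P) *\<^sub>v (B ^\<^sub>m j *\<^sub>v x) = 0\<^sub>v n"
    using D(6,7) Bk xD(1) by (simp add: assoc_mult_mat_vec[of _ n n _ n])
  then have "B ^\<^sub>m j *\<^sub>v x = 0\<^sub>v n" using D(2) Bk xD(1) by simp
  then show "x \<in> mat_kernel (B ^\<^sub>m j)" by (rule mat_kernelI[OF Bk xD(1)])
qed

text \<open>Padding by \<open>0\<^sub>v p\<close> embeds the kernels of the powers of
  \<open>C\<close> in those of the block sum, which stabilise at \<open>ascent A\<close>. This keeps
  the next Jordan block from being larger than the one just removed.\<close>

lemma ascent_direct_summand_le:
  fixes J C :: "complex mat"
  assumes A: "A \<in> carrier_mat n n" and J: "J \<in> carrier_mat p p" and C: "C \<in> carrier_mat m m"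
    and wit: "similar_mat_wit A (four_block_mat J (0\<^sub>m p m) (0\<^sub>m m p) C) P Q"
  shows "ascent C \<le> ascent A"
proof -
  let ?M = "four_block_mat J (0\<^sub>m p m) (0\<^sub>m m p) C" and ?a = "ascent A"
  have Ck: "C ^\<^sub>m k \<in> carrier_mat m m" and Jk: "J ^\<^sub>m k \<in> carrier_mat p p" for k using C J by auto
  have sub: "mat_kernel (?M ^\<^sub>m (?a + 1)) \<subseteq> mat_kernel (?M ^\<^sub>m ?a)"
    using mat_kernel_pow_similar[OF wit A] mat_kernel_ascent[OF A] by blast
  have "mat_kernel (C ^\<^sub>m (?a + 1)) \<subseteq> mat_kernel (C ^\<^sub>m ?a)"
  proof
    fix x assume x: "x \<in> mat_kernel (C ^\<^sub>m (?a + 1))"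
    note xD = mat_kernelD[OF Ck x]
    have Mv: "?M ^\<^sub>m k *\<^sub>v (0\<^sub>v p @\<^sub>v x) = 0\<^sub>v p @\<^sub>v C ^\<^sub>m k *\<^sub>v x" for k
      using mult_mat_vec_split[OF Jk Ck zero_carrier_vec xD(1), of k k] pow_four_block_mat[OF J C, of k]
        mult_mat_vec_zero[OF Jk, of k] by simp
    have Mk: "?M ^\<^sub>m k \<in> carrier_mat (p + m) (p + m)" for k
      using four_block_carrier_mat[OF J C] by simp
    have v: "0\<^sub>v p @\<^sub>v x \<in> carrier_vec (p + m)" using xD(1) by simp
    have "0\<^sub>v p @\<^sub>v x \<in> mat_kernel (?M ^\<^sub>m (?a + 1))"
      by (rule mat_kernelI[OF Mk v]) (simp only: Mv xD(2), auto)
    then have "?M ^\<^sub>m ?a *\<^sub>v (0\<^sub>v p @\<^sub>v x) = 0\<^sub>v (p + m)" using sub mat_kernelD(2)[OF Mk] by blast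
    then have "0\<^sub>v p @\<^sub>v C ^\<^sub>m ?a *\<^sub>v x = 0\<^sub>v p @\<^sub>v 0\<^sub>v m" unfolding Mv by auto
    then have "C ^\<^sub>m ?a *\<^sub>v x = 0\<^sub>v m"
      using append_vec_eq[of "0\<^sub>v p :: complex vec" p "0\<^sub>v p"] by simp
    then show "x \<in> mat_kernel (C ^\<^sub>m ?a)" by (rule mat_kernelI[OF Ck xD(1)])
  qed
  then have "mat_kernel (C ^\<^sub>m ?a) = mat_kernel (C ^\<^sub>m (?a + 1))"
    using mat_kernel_pow_Suc_subset[OF C, of ?a] by blast
  then show ?thesis unfolding ascent_def[of C] by (rule Least_le)
qed

section \<open>Induction on the size; (c) implies (b)\<close>

text \<open>Each step with positive ascent puts one Jordan block in front of the decomposition of a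
  strictly smaller matrix. The unitary summand stands last, so a new block is just a list
  constructor.\<close>

lemma exists_jordan_unitary_sum:
  fixes A :: "complex mat"
  assumes "A \<in> carrier_mat n n" "\<And>j. 1 \<le> j \<Longrightarrow> partial_isometry (A ^\<^sub>m j)"
  shows "\<exists>U ks. unitary_mat U \<and> sorted_wrt (\<ge>) ks \<and> (\<forall>k\<in>set ks. k \<ge> 1) \<and>
    (if ascent A = 0 then ks = [] else ks \<noteq> [] \<and> hd ks = ascent A) \<and>
    unitarily_similar A (diag_block_mat (map (\<lambda>k. jordan_block k 0) ks @ [U]))"
  using assms
proof (induction n arbitrary: A rule: less_induct)
  case (less n)
  note A = less.prems(1) and pi = less.prems(2)
  show ?case
  proof (cases "ascent A")
    case 0
    \<comment> \<open>With ascent 0 the kernel of \<open>A\<close> is that of the identity, so the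
      left factor \<open>A\<close> can be cancelled, leaving \<open>A\<^sup>* A = 1\<close>.\<close>
    have "A * mat_adjoint A * A = A" using partial_isometryD[OF A] pi[of 1] A by simp
    then have E: "A * (mat_adjoint A * A) = A * 1\<^sub>m n"
      using A by (simp add: assoc_mult_mat[of _ n n _ n _ n])
    have "mat_kernel A \<subseteq> mat_kernel (1\<^sub>m n)" using mat_kernel_ascent[OF A] 0 A by simp
    then have "1\<^sub>m n * (mat_adjoint A * A) = 1\<^sub>m n * 1\<^sub>m n"
      using A by (intro mat_kernel_cancel_left[OF A one_carrier_mat _ one_carrier_mat _ E])
        (auto simp: mult_carrier_mat[of _ n n _ n])
    then have "unitary_mat A"
      using A by (intro unitary_matI[OF A]) (simp add: mult_carrier_mat[of _ n n _ n])
    moreover have "unitarily_similar A A"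
      using similar_mat_wit_refl[OF A] unitary_mat_one[of n] unfolding unitarily_similar_def
      by (intro exI[of _ "1\<^sub>m n"]) simp
    ultimately show ?thesis using 0 by (intro exI[of _ A] exI[of _ "[]"]) (simp del: diag_block_mat.simps)
  next
    case (Suc k)
    let ?p = "Suc k" and ?J = "jordan_block (Suc k) 0 :: complex mat"
    obtain m C P where n: "n = ?p + m" and C: "C \<in> carrier_mat m m" and P: "unitary_mat P"
      and wit: "similar_mat_wit A (four_block_mat ?J (0\<^sub>m ?p m) (0\<^sub>m m ?p) C) P (mat_adjoint P)"
      using split_off_jordan_block[OF A pi Suc] by blast
    have piC: "partial_isometry (C ^\<^sub>m j)" if "1 \<le> j" for j
    proof -
      let ?M = "four_block_mat ?J (0\<^sub>m ?p m) (0\<^sub>m m ?p) C"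
      have "similar_mat_wit (?M ^\<^sub>m j) (A ^\<^sub>m j) (mat_adjoint P) (mat_adjoint (mat_adjoint P))"
        using similar_mat_wit_sym[OF similar_mat_wit_pow[OF wit, of j]]
        by (simp only: mat_adjoint_adjoint)
      then have "partial_isometry (?M ^\<^sub>m j)"
        by (rule partial_isometry_unitarily_similar[OF pi[OF that]])
      then show ?thesis
        unfolding pow_four_block_mat[OF jordan_block_carrier C]
          partial_isometry_direct_sum[OF pow_carrier_mat[OF jordan_block_carrier] pow_carrier_mat[OF C]]
        by blast
    qed
    have le: "ascent C \<le> ?p"
      using ascent_direct_summand_le[OF A jordan_block_carrier C wit] Suc by simp
    obtain U ks where U: "unitary_mat U" and ks: "sorted_wrt (\<ge>) ks" "\<forall>k\<in>set ks. k \<ge> 1"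
      and hd: "if ascent C = 0 then ks = [] else ks \<noteq> [] \<and> hd ks = ascent C"
      and sim: "unitarily_similar C (diag_block_mat (map (\<lambda>k. jordan_block k 0) ks @ [U]))"
      using less.IH[OF _ C piC] n by auto
    let ?D = "diag_block_mat (map (\<lambda>k. jordan_block k 0) ks @ [U])"
    have D: "?D \<in> carrier_mat m m"
      using sim similar_mat_witD2[OF C] unfolding unitarily_similar_def by blast
    \<comment> \<open>The head of \<open>ks\<close> is \<open>ascent C\<close>, which is at most
      \<open>?p\<close>, and the list is decreasing.\<close>
    have "\<forall>k\<in>set ks. k \<le> ?p"
      using hd ks(1) le by (cases ks) (auto split: if_splits)
    then have "sorted_wrt (\<ge>) (?p # ks)" using ks(1) by simp
    moreover have "unitarily_similar A (four_block_mat ?J (0\<^sub>m ?p m) (0\<^sub>m m ?p) C)"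
      using P wit unfolding unitarily_similar_def by blast
    then have "unitarily_similar A (four_block_mat ?J (0\<^sub>m ?p m) (0\<^sub>m m ?p) ?D)"
      by (rule unitarily_similar_trans[OF _ unitarily_similar_direct_sum[OF jordan_block_carrier C sim]])
    then have "unitarily_similar A (diag_block_mat (map (\<lambda>k. jordan_block k 0) (?p # ks) @ [U]))"
      using carrier_matD[OF D] by (simp add: Let_def)
    ultimately show ?thesis
      using U ks(2) Suc by (intro exI[of _ U] exI[of _ "?p # ks"]) simp
  qed
qed

lemma unitarily_similar_diag_block_rotate:
  fixes A U :: "complex mat"
  assumes U: "unitary_mat U"
    and sim: "unitarily_similar A (diag_block_mat (map (\<lambda>k. jordan_block k 0) ks @ [U]))"
  shows "unitarily_similar A (diag_block_mat (U # map (\<lambda>k. jordan_block k 0) ks))"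
proof -
  let ?K = "diag_block_mat (map (\<lambda>k. jordan_block k (0 :: complex)) ks)"
  have "square_mat ?K" by (rule diag_block_mat_square) auto
  then have dK: "dim_col ?K = dim_row ?K" by simp
  have dU: "dim_col U = dim_row U" using U by (simp add: unitary_mat_def)
  have "unitarily_similar
      (four_block_mat ?K (0\<^sub>m (dim_row ?K) (dim_row U)) (0\<^sub>m (dim_row U) (dim_row ?K)) U)
      (four_block_mat U (0\<^sub>m (dim_row U) (dim_row ?K)) (0\<^sub>m (dim_row ?K) (dim_row U)) ?K)"
    by (intro unitarily_similar_swap carrier_matI dK dU refl)
  then have "unitarily_similar (diag_block_mat (map (\<lambda>k. jordan_block k 0) ks @ [U]))
      (diag_block_mat (U # map (\<lambda>k. jordan_block k 0) ks))"
    by (simp only: diag_block_mat_last diag_block_mat.simps Let_def dK dU)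
  then show ?thesis using sim unitarily_similar_trans by blast
qed

theorem theorem2p4:
  fixes A :: "complex mat" and n l :: nat
  assumes "A \<in> carrier_mat n n"
    and "l > ascent A"
  defines "a \<equiv> (\<forall>j\<in>{1..l}. partial_isometry (A ^\<^sub>m j))"
    and "b \<equiv> (\<exists>U ks. unitary_mat U \<and>
          sorted_wrt (\<ge>) ks \<and> (\<forall>k\<in>set ks. k \<ge> 1) \<and>
          (if ascent A = 0 then ks = [] else ks \<noteq> [] \<and> hd ks = ascent A) \<and>
          unitarily_similar A (diag_block_mat (U # map (\<lambda>k. jordan_block k 0) ks)))"
    and "c \<equiv> (\<forall>j\<ge>1. partial_isometry (A ^\<^sub>m j))"
  shows "(a \<longleftrightarrow> b) \<and> (b \<longleftrightarrow> c)"
proof -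
  have "c" if a
  proof -
    \<comment> \<open>The strict inequality \<open>l > ascent A\<close> makes the exponent
      \<open>ascent A + 1\<close> available.\<close>
    have "partial_isometry (A ^\<^sub>m j)" if "1 \<le> j" "j \<le> ascent A + 1" for j
      using \<open>a\<close> that assms(2) unfolding a_def by auto
    then show c
      unfolding c_def using partial_isometry_all_pows[OF assms(1) mat_kernel_ascent[OF assms(1)]]
      by blast
  qed
  moreover have "b" if c
    using exists_jordan_unitary_sum[OF assms(1)] that unitarily_similar_diag_block_rotate
    unfolding b_def c_def by meson
  moreover have "c" if b
    using that partial_isometry_pow_unitary_jordan_sum unfolding b_def c_def by blast
  moreover have "a" if c
    using that unfolding a_def c_def by auto
  ultimately show ?thesis by blast
qed

end
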